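(* Let $X$ be the complex space $l^p$ with $1\le p<\infty$ or the complex space $c_0$, and let $B_w:X\to X$ be a hypercyclic weighted shift. Then $B_w$ possesses a hypercyclic subspace if and only if $$\sup_{n\ge 1}\inf_{k\ge 1}\prod_{\nu=1}^n|w_{\nu+k}|\le 1,$$ or equivalently if and only if $$\sup_{n\ge 1}\inf_{k\ge 1}\prod_{\nu=1}^n|w_{\nu+k}|<\infty.$$
   Context: Sequences are indexed by $n\ge1$ and $(e_n)_{n\ge1}$ is the canonical basis. For a sequence $w=(w_n)_{n\ge 1}$ of non-zero scalars, the weighted shift $B_w:X\to X$ is the continuous linear operator with $B_we_n=w_ne_{n-1}$ for $n\ge1$, where $e_0=0$. A vector $x$ is hypercyclic for $B_w$ if $\{B_w^nx:n\ge 1\}$ is dense in $X$; $B_w$ is hypercyclic if it has a hypercyclic vector. A hypercyclic subspace for $B_w$ is an infinite-dimensional closed linear subspace of $X$ in which every non-zero vector is hypercyclic for $B_w$. *)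

theory Defs
  imports "HOL-Analysis.Analysis" "HOL-Library.Function_Algebras"
begin

text \<open>
  A scalar sequence indexed by \<open>n \<ge> 1\<close> is a function on \<open>nat\<close> that vanishes at \<open>0\<close>; the
  indices of the mathematics are thereby kept, and the convention that the basis vector
  with index \<open>0\<close> is the zero vector is respected.
\<close>

definition cscale :: "complex \<Rightarrow> (nat \<Rightarrow> complex) \<Rightarrow> (nat \<Rightarrow> complex)" where
  "cscale c x = (\<lambda>n. c * x n)"

interpretation cseq: vector_space cscale
  by unfold_locales (auto simp: cscale_def fun_eq_iff algebra_simps)

definition unit_seq :: "nat \<Rightarrow> nat \<Rightarrow> complex" where
  "unit_seq n = (\<lambda>k. if k = n \<and> n \<ge> 1 then 1 else 0)"

definition lp_space :: "real \<Rightarrow> (nat \<Rightarrow> complex) set" where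
  "lp_space p = {x. x 0 = 0 \<and> summable (\<lambda>n. cmod (x n) powr p)}"

definition lp_norm :: "real \<Rightarrow> (nat \<Rightarrow> complex) \<Rightarrow> real" where
  "lp_norm p x = (\<Sum>n. cmod (x n) powr p) powr (1 / p)"

definition c0_space :: "(nat \<Rightarrow> complex) set" where
  "c0_space = {x. x 0 = 0 \<and> x \<longlonglongrightarrow> 0}"

definition c0_norm :: "(nat \<Rightarrow> complex) \<Rightarrow> real" where
  "c0_norm x = (SUP n. cmod (x n))"

text \<open>
  In the following, \<open>X\<close> is the carrier of a sequence space and \<open>N\<close> its norm. The distance is
  set to \<open>0\<close> outside \<open>X\<close> because the locale \<open>Metric_space\<close> demands nonnegativity and
  symmetry on the whole type, where the value of \<open>N\<close> is meaningless.
\<close>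

definition norm_dist :: "(nat \<Rightarrow> complex) set \<Rightarrow> ((nat \<Rightarrow> complex) \<Rightarrow> real)
    \<Rightarrow> (nat \<Rightarrow> complex) \<Rightarrow> (nat \<Rightarrow> complex) \<Rightarrow> real" where
  "norm_dist X N x y = (if x \<in> X \<and> y \<in> X then N (x - y) else 0)"

definition norm_topology :: "(nat \<Rightarrow> complex) set \<Rightarrow> ((nat \<Rightarrow> complex) \<Rightarrow> real)
    \<Rightarrow> (nat \<Rightarrow> complex) topology" where
  "norm_topology X N = Metric_space.mtopology X (norm_dist X N)"

definition continuous_linear_operator :: "(nat \<Rightarrow> complex) set \<Rightarrow> ((nat \<Rightarrow> complex) \<Rightarrow> real)
    \<Rightarrow> ((nat \<Rightarrow> complex) \<Rightarrow> (nat \<Rightarrow> complex)) \<Rightarrow> bool" where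
  "continuous_linear_operator X N T \<longleftrightarrow>
     T ` X \<subseteq> X \<and>
     (\<forall>x\<in>X. \<forall>y\<in>X. T (x + y) = T x + T y) \<and>
     (\<forall>c. \<forall>x\<in>X. T (cscale c x) = cscale c (T x)) \<and>
     continuous_map (norm_topology X N) (norm_topology X N) T"

definition weighted_shift :: "(nat \<Rightarrow> complex) set \<Rightarrow> ((nat \<Rightarrow> complex) \<Rightarrow> real)
    \<Rightarrow> (nat \<Rightarrow> complex) \<Rightarrow> ((nat \<Rightarrow> complex) \<Rightarrow> (nat \<Rightarrow> complex)) \<Rightarrow> bool" where
  "weighted_shift X N w B \<longleftrightarrow>
     continuous_linear_operator X N B \<and>
     (\<forall>n\<ge>1. w n \<noteq> 0) \<and>
     (\<forall>n\<ge>1. B (unit_seq n) = cscale (w n) (unit_seq (n - 1)))"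

definition hypercyclic_vector :: "(nat \<Rightarrow> complex) set \<Rightarrow> ((nat \<Rightarrow> complex) \<Rightarrow> real)
    \<Rightarrow> ((nat \<Rightarrow> complex) \<Rightarrow> (nat \<Rightarrow> complex)) \<Rightarrow> (nat \<Rightarrow> complex) \<Rightarrow> bool" where
  "hypercyclic_vector X N T x \<longleftrightarrow>
     x \<in> X \<and> norm_topology X N closure_of {(T ^^ n) x |n. n \<ge> 1} = X"

definition hypercyclic :: "(nat \<Rightarrow> complex) set \<Rightarrow> ((nat \<Rightarrow> complex) \<Rightarrow> real)
    \<Rightarrow> ((nat \<Rightarrow> complex) \<Rightarrow> (nat \<Rightarrow> complex)) \<Rightarrow> bool" where
  "hypercyclic X N T \<longleftrightarrow> (\<exists>x. hypercyclic_vector X N T x)"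

definition infinite_dimensional :: "(nat \<Rightarrow> complex) set \<Rightarrow> bool" where
  "infinite_dimensional V \<longleftrightarrow> \<not> (\<exists>S. finite S \<and> V \<subseteq> cseq.span S)"

definition hypercyclic_subspace :: "(nat \<Rightarrow> complex) set \<Rightarrow> ((nat \<Rightarrow> complex) \<Rightarrow> real)
    \<Rightarrow> ((nat \<Rightarrow> complex) \<Rightarrow> (nat \<Rightarrow> complex)) \<Rightarrow> (nat \<Rightarrow> complex) set \<Rightarrow> bool" where
  "hypercyclic_subspace X N T V \<longleftrightarrow>
     V \<subseteq> X \<and> cseq.subspace V \<and> closedin (norm_topology X N) V \<and> infinite_dimensional V \<and>
     (\<forall>x\<in>V. x \<noteq> 0 \<longrightarrow> hypercyclic_vector X N T x)"

end

theory Submission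
  imports Defs
begin

text \<open>
  If some product of \<open>n0\<close> consecutive weights is bounded below by \<open>a > 1\<close> uniformly in its position,
  then \<open>B\<^sup>n\<close> expands the part of a vector beyond the index \<open>n\<close> at a uniform exponential rate; every
  infinite-dimensional closed subspace contains a vector whose tails decay more slowly than that,
  and its orbit stays away from \<open>0\<close>. Conversely, if the supremum is finite then for all \<open>n0\<close> there are
  arbitrarily large \<open>k\<close> such that all products of at most \<open>n0\<close> consecutive weights ending at \<open>w\<^sub>k\<close> are at
  most \<open>2\<close>. Along such indices \<open>k\<^sub>j\<close> the orbits of the \<open>e\<^bsub>k\<^sub>j\<^esub>\<close> remain bounded at prescribed times, and
  a small perturbation of the closed span of these basis vectors is a hypercyclic subspace.
\<close>

subsection \<open>Solid sequence spaces\<close>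

text \<open>The two criteria coincide because each implication gives more than it must: a
  hypercyclic subspace forces the supremum to be at most 1, while mere finiteness already produces
  one. Finiteness is exploited by contradiction: if every index beyond some point ended a short
  product exceeding 2, concatenating such products would make all long products large, wherever they
  start. Any constant above 1 could replace 2.

  The obstacle in the construction is that every non-zero vector of the subspace must be
  hypercyclic, whereas the orbits of basis vectors end in 0. Each target is therefore attached to
  one label, and every label receives a dense set of targets; a vector with a single non-zero
  coefficient then approximates everything at the times belonging to that label. Describing the
  subspace by equations between coordinates makes its closedness elementary. Both kinds of spaces
  are treated at once, through solidity of the norm and completeness.\<close>

definition back_shift :: "nat \<Rightarrow> (nat \<Rightarrow> complex) \<Rightarrow> nat \<Rightarrow> complex" where
  "back_shift m x = (\<lambda>i. if i = 0 then 0 else x (i + m))"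

definition seq_tail :: "nat \<Rightarrow> (nat \<Rightarrow> complex) \<Rightarrow> nat \<Rightarrow> complex" where
  "seq_tail m x = (\<lambda>i. if i > m then x i else 0)"

text \<open>Properties shared by l^p and c_0. Solidity turns bounds on weights into bounds on norms,
  \<open>norm_shift\<close> compares orbits with tails, and \<open>tail_tendsto\<close> is what
  fails for the space of bounded sequences.\<close>

locale solid_seq_space =
  fixes X :: "(nat \<Rightarrow> complex) set" and N :: "(nat \<Rightarrow> complex) \<Rightarrow> real"
  assumes coord_0: "x \<in> X \<Longrightarrow> x 0 = 0"
    and coord_le: "x \<in> X \<Longrightarrow> cmod (x n) \<le> N x"
    and add_in: "x \<in> X \<Longrightarrow> y \<in> X \<Longrightarrow> x + y \<in> X"
    and norm_add: "x \<in> X \<Longrightarrow> y \<in> X \<Longrightarrow> N (x + y) \<le> N x + N y"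
    and scale_in: "x \<in> X \<Longrightarrow> cscale c x \<in> X"
    and norm_scale: "x \<in> X \<Longrightarrow> N (cscale c x) = cmod c * N x"
    and solid_in: "x \<in> X \<Longrightarrow> (\<And>n. cmod (y n) \<le> cmod (x n)) \<Longrightarrow> y \<in> X"
    and norm_mono: "x \<in> X \<Longrightarrow> (\<And>n. cmod (y n) \<le> cmod (x n)) \<Longrightarrow> N y \<le> N x"
    and unit_in: "unit_seq n \<in> X"
    and norm_unit: "N (unit_seq n) \<le> 1"
    and shift_in: "x \<in> X \<Longrightarrow> back_shift m x \<in> X"
    and norm_shift: "x \<in> X \<Longrightarrow> N (back_shift m x) = N (seq_tail m x)"
    and tail_tendsto: "x \<in> X \<Longrightarrow> (\<lambda>m. N (seq_tail m x)) \<longlonglongrightarrow> 0"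
begin

lemma norm_nonneg: "x \<in> X \<Longrightarrow> 0 \<le> N x"
  using coord_le[of x 0] norm_ge_zero order_trans by blast

lemma zero_in: "0 \<in> X"
proof -
  have "cscale 0 (unit_seq 1) \<in> X" by (intro scale_in unit_in)
  then show ?thesis by (simp add: cscale_def zero_fun_def)
qed

lemma norm_zero: "N 0 = 0"
proof -
  have "cscale 0 (unit_seq 1) = 0" by (simp add: cscale_def fun_eq_iff)
  with norm_scale[OF unit_in, of 0 1] show ?thesis by simp
qed

lemma norm_eq_0: "x \<in> X \<Longrightarrow> N x = 0 \<longleftrightarrow> x = 0"
  using coord_le[of x] norm_zero by (metis ext norm_le_zero_iff zero_fun_apply)

lemma uminus_eq: "- x = cscale (-1) x"
  by (simp add: cscale_def fun_eq_iff)

lemma diff_in: "x \<in> X \<Longrightarrow> y \<in> X \<Longrightarrow> x - y \<in> X"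
  using add_in[of x "- y"] scale_in[of y "-1"] by (simp add: uminus_eq[symmetric])

lemma norm_minus_commute: "x \<in> X \<Longrightarrow> y \<in> X \<Longrightarrow> N (x - y) = N (y - x)"
  using norm_scale[of "x - y" "-1"] diff_in[of x y] by (simp add: uminus_eq[symmetric])

lemma norm_diff: "x \<in> X \<Longrightarrow> y \<in> X \<Longrightarrow> N (x - y) \<le> N x + N y"
  using norm_add[of x "- y"] scale_in[of y "-1"] norm_scale[of y "-1"]
  by (simp add: uminus_eq[symmetric])

lemma norm_diff_triangle:
  "x \<in> X \<Longrightarrow> y \<in> X \<Longrightarrow> z \<in> X \<Longrightarrow> N (x - z) \<le> N (x - y) + N (y - z)"
  using norm_add[of "x - y" "y - z"] diff_in[of x y] diff_in[of y z] by simp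

lemma tail_in: "x \<in> X \<Longrightarrow> seq_tail m x \<in> X"
  by (rule solid_in) (auto simp: seq_tail_def)

lemma norm_tail_mono: "x \<in> X \<Longrightarrow> m \<le> n \<Longrightarrow> N (seq_tail n x) \<le> N (seq_tail m x)"
  by (rule norm_mono) (auto simp: seq_tail_def intro: solid_in)

lemma norm_tail_le: "x \<in> X \<Longrightarrow> N (seq_tail m x) \<le> N x"
  by (rule norm_mono) (auto simp: seq_tail_def)

lemma sum_in: "(\<And>i. i < n \<Longrightarrow> u i \<in> X) \<Longrightarrow> (\<lambda>m. \<Sum>i<(n::nat). u i m) \<in> X"
proof (induction n)
  case 0
  then show ?case using zero_in by (simp add: zero_fun_def)
next
  case (Suc n)
  then have "(\<lambda>m. \<Sum>i<n. u i m) + u n \<in> X" by (intro add_in) auto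
  then show ?case by (simp add: plus_fun_def)
qed

lemma norm_sum_le:
  "(\<And>i. i < n \<Longrightarrow> u i \<in> X) \<Longrightarrow> N (\<lambda>m. \<Sum>i<(n::nat). u i m) \<le> (\<Sum>i<n. N (u i))"
proof (induction n)
  case 0
  then show ?case using norm_zero by (simp add: zero_fun_def)
next
  case (Suc n)
  have "N ((\<lambda>m. \<Sum>i<n. u i m) + u n) \<le> N (\<lambda>m. \<Sum>i<n. u i m) + N (u n)"
    using Suc.prems by (intro norm_add sum_in) auto
  also have "\<dots> \<le> (\<Sum>i<n. N (u i)) + N (u n)"
    using Suc by auto
  finally show ?case by (simp add: plus_fun_def)
qed

lemma summable_coord:
  assumes "\<And>i. u i \<in> X" "summable (\<lambda>i. N (u i))"
  shows "summable (\<lambda>i. u i m)"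
  by (rule summable_norm_cancel, rule summable_comparison_test'[OF assms(2), of 0])
     (use coord_le assms(1) in auto)

sublocale Metric_space X "norm_dist X N"
proof
  fix x y z
  show "0 \<le> norm_dist X N x y" by (simp add: norm_dist_def norm_nonneg diff_in)
  show "norm_dist X N x y = norm_dist X N y x"
    by (simp add: norm_dist_def norm_minus_commute)
  show "norm_dist X N x y = 0 \<longleftrightarrow> x = y" if "x \<in> X" "y \<in> X"
    using that by (simp add: norm_dist_def norm_eq_0 diff_in)
  show "norm_dist X N x z \<le> norm_dist X N x y + norm_dist X N y z"
    if "x \<in> X" "y \<in> X" "z \<in> X"
    using that by (simp add: norm_dist_def norm_diff_triangle)
qed

lemma topspace_norm_topology: "topspace (norm_topology X N) = X"
  by (simp add: norm_topology_def)

lemma in_closure_of_iff: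
  assumes "S \<subseteq> X"
  shows "x \<in> norm_topology X N closure_of S \<longleftrightarrow> x \<in> X \<and> (\<forall>r>0. \<exists>y\<in>S. N (y - x) < r)"
  using assms unfolding norm_topology_def metric_closure_of
  by (auto simp: norm_dist_def subset_iff) (metis norm_minus_commute)+

lemma closedin_iff:
  assumes "V \<subseteq> X"
  shows "closedin (norm_topology X N) V \<longleftrightarrow>
    (\<forall>x\<in>X. (\<forall>r>0. \<exists>y\<in>V. N (y - x) < r) \<longrightarrow> x \<in> V)"
  using assms in_closure_of_iff[OF assms] topspace_norm_topology
    closure_of_subset_eq[of V "norm_topology X N"] by blast

lemma bounded_operator:
  assumes "continuous_linear_operator X N T"
  obtains D where "D > 0" "\<And>x. x \<in> X \<Longrightarrow> N (T x) \<le> D * N x"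
proof -
  from assms have TX: "T x \<in> X" if "x \<in> X" for x
    using that by (auto simp: continuous_linear_operator_def)
  from assms have Ts: "T (cscale c x) = cscale c (T x)" if "x \<in> X" for c x
    using that by (auto simp: continuous_linear_operator_def)
  have T0: "T 0 = 0"
    using Ts[OF zero_in, of 0] by (simp add: cscale_def zero_fun_def)
  have "openin (norm_topology X N) {x \<in> X. T x \<in> mball 0 1}"
    using assms openin_continuous_map_preimage[of "norm_topology X N" "norm_topology X N" T "mball 0 1"]
    by (auto simp: continuous_linear_operator_def norm_topology_def)
  moreover have "0 \<in> {x \<in> X. T x \<in> mball 0 1}"
    using zero_in T0 by simp
  ultimately obtain r where r: "r > 0" "mball 0 r \<subseteq> {x \<in> X. T x \<in> mball 0 1}"
    unfolding norm_topology_def openin_mtopology by blast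
  have small: "N (T x) < 1" if "x \<in> X" "N x < r" for x
  proof -
    have "x \<in> mball 0 r"
      using that zero_in norm_minus_commute[of 0 x] by (simp add: norm_dist_def)
    then have "T x \<in> mball 0 1" using r by blast
    then show ?thesis
      using zero_in norm_minus_commute[of 0 "T x"] TX[OF that(1)] by (simp add: norm_dist_def)
  qed
  have "N (T x) \<le> (2 / r) * N x" if x: "x \<in> X" for x
  proof (cases "N x = 0")
    case True
    then show ?thesis using T0 norm_eq_0[OF x] norm_zero by simp
  next
    case False
    with norm_nonneg[OF x] have pos: "N x > 0" by simp
    \<comment> \<open>Rescaling to norm r/2 puts the vector strictly inside the ball of radius
      \<open>r\<close>; hence the final constant 2/r.\<close>
    let ?c = "complex_of_real (r / (2 * N x))"
    have "N (cscale ?c x) = r / 2"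
      using pos r(1) by (simp only: norm_scale[OF x] norm_of_real) (simp add: field_simps)
    then have "N (cscale ?c (T x)) < 1"
      using small[of "cscale ?c x"] r(1) scale_in[OF x] Ts[OF x] by simp
    moreover have "N (cscale ?c (T x)) = r / (2 * N x) * N (T x)"
      using pos r(1) by (simp only: norm_scale[OF TX[OF x]] norm_of_real) simp
    ultimately have "r / (2 * N x) * N (T x) < 1" by linarith
    then show ?thesis using pos r(1) by (simp add: field_simps)
  qed
  then show thesis using that[of "2 / r"] r(1) by simp
qed

end

text \<open>Completeness in the form of absolutely convergent series, summed coordinatewise. Applied
  to remainders, the norm bound yields convergence in norm.\<close>

locale banach_seq_space = solid_seq_space +
  assumes series_in:
      "(\<And>i. u i \<in> X) \<Longrightarrow> summable (\<lambda>i. N (u i)) \<Longrightarrow> (\<lambda>m. \<Sum>i. u i m) \<in> X"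
    and norm_series:
      "(\<And>i. u i \<in> X) \<Longrightarrow> summable (\<lambda>i. N (u i)) \<Longrightarrow> N (\<lambda>m. \<Sum>i. u i m) \<le> (\<Sum>i. N (u i))"

subsection \<open>The spaces \<open>l\<^sup>p\<close> and \<open>c\<^sub>0\<close>\<close>

text \<open>For positive \<open>a\<close> and \<open>b\<close> this is convexity of the power
  function; if one of them is 0 it reduces to \<open>s powr p \<le> s\<close> for \<open>s\<close>
  in [0,1].\<close>

lemma powr_convex_nonneg:
  fixes a b :: real
  assumes "p \<ge> 1" "a \<ge> 0" "b \<ge> 0" "0 \<le> t" "t \<le> 1"
  shows "(t * a + (1 - t) * b) powr p \<le> t * a powr p + (1 - t) * b powr p"
proof -
  have scale: "(s * c) powr p \<le> s * c powr p" if "0 \<le> s" "s \<le> 1" "c \<ge> 0" for s c :: real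
  proof -
    have "s powr p \<le> s"
    proof (cases "s = 0")
      case False
      then have "s powr p \<le> s powr 1" using that assms by (intro powr_mono') auto
      then show ?thesis using that by simp
    qed simp
    then show ?thesis using that by (simp add: powr_mult mult_right_mono)
  qed
  consider "a = 0" | "b = 0" | "a > 0" "b > 0" using assms by linarith
  then show ?thesis
  proof cases
    case 1
    then show ?thesis using scale[of "1 - t" b] assms by simp
  next
    case 2
    then show ?thesis using scale[of t a] assms by simp
  next
    case 3
    then show ?thesis
      using convex_onD[OF powr_convex[OF assms(1)], of "1 - t" a b] assms by simp
  qed
qed

lemma lp_sum_le:
  assumes "p \<ge> 1" "x \<in> lp_space p"
  shows "(\<Sum>n<K. cmod (x n) powr p) \<le> lp_norm p x powr p"
proof -
  have s: "summable (\<lambda>n. cmod (x n) powr p)" using assms by (simp add: lp_space_def)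
  have "lp_norm p x powr p = (\<Sum>n. cmod (x n) powr p)"
    using assms suminf_nonneg[OF s] by (simp add: lp_norm_def powr_powr)
  then show ?thesis using sum_le_suminf[OF s, of "{..<K}"] by simp
qed

text \<open>Together with \<open>lp_sum_le\<close> this reduces the Minkowski inequality, solidity
  and completeness to inequalities between finite sums.\<close>

lemma lp_normI:
  assumes "p \<ge> 1" "x 0 = 0" "0 \<le> C" "\<And>K. (\<Sum>n<K. cmod (x n) powr p) \<le> C powr p"
  shows "x \<in> lp_space p" "lp_norm p x \<le> C"
proof -
  have s: "summable (\<lambda>n. cmod (x n) powr p)"
    by (rule summableI_nonneg_bounded[of _ "C powr p"]) (use assms in auto)
  then show "x \<in> lp_space p" using assms by (simp add: lp_space_def)
  have "(\<Sum>n. cmod (x n) powr p) \<le> C powr p"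
    by (rule suminf_le_const[OF s assms(4)])
  then have "lp_norm p x \<le> (C powr p) powr (1 / p)"
    unfolding lp_norm_def using assms by (intro powr_mono2) (auto intro: suminf_nonneg s)
  then show "lp_norm p x \<le> C" using assms by (simp add: powr_powr)
qed

lemma lp_norm_nonneg: "lp_norm p x \<ge> 0"
  by (simp add: lp_norm_def)

lemma lp_minkowski:
  assumes p: "p \<ge> 1" and x: "x \<in> lp_space p" and y: "y \<in> lp_space p"
  shows "x + y \<in> lp_space p" "lp_norm p (x + y) \<le> lp_norm p x + lp_norm p y"
proof -
  let ?a = "lp_norm p x" and ?b = "lp_norm p y"
  have key: "(\<Sum>n<K. cmod ((x + y) n) powr p) \<le> (A + B) powr p"
    if A: "A > ?a" and B: "B > ?b" for A B and K :: nat
  proof -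
    have pos: "A > 0" "B > 0" using A B lp_norm_nonneg[of p x] lp_norm_nonneg[of p y] by linarith+
    \<comment> \<open>\<open>A\<close> and \<open>B\<close> exceed the norms strictly, so they are
      positive even for zero vectors. Now x + y is A + B times the convex combination of x/A and y/B
      with weight \<open>t\<close>.\<close>
    define t where "t = A / (A + B)"
    have t: "0 \<le> t" "t \<le> 1" "1 - t = B / (A + B)" "(A + B) * t = A" "(A + B) * (1 - t) = B"
      using pos by (auto simp: t_def field_simps)
    have le: "cmod ((x + y) n) powr p \<le>
        (A + B) powr p * (t * (cmod (x n) powr p / A powr p) + (1 - t) * (cmod (y n) powr p / B powr p))"
      for n
    proof -
      have "cmod ((x + y) n) \<le> cmod (x n) + cmod (y n)" by (simp add: norm_triangle_ineq)
      also have "\<dots> = (A + B) * t * (cmod (x n) / A) + (A + B) * (1 - t) * (cmod (y n) / B)"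
        using pos by (simp add: t(4,5))
      also have "\<dots> = (A + B) * (t * (cmod (x n) / A) + (1 - t) * (cmod (y n) / B))"
        by (simp only: distrib_left mult.assoc)
      finally have "cmod ((x + y) n) powr p \<le>
          ((A + B) * (t * (cmod (x n) / A) + (1 - t) * (cmod (y n) / B))) powr p"
        using p by (intro powr_mono2) auto
      also have "\<dots> = (A + B) powr p * (t * (cmod (x n) / A) + (1 - t) * (cmod (y n) / B)) powr p"
        by (rule powr_mult)
      also have "\<dots> \<le> (A + B) powr p *
          (t * (cmod (x n) / A) powr p + (1 - t) * (cmod (y n) / B) powr p)"
        using pos t p by (intro mult_left_mono powr_convex_nonneg) auto
      also have "\<dots> = (A + B) powr p * (t * (cmod (x n) powr p / A powr p) + (1 - t) * (cmod (y n) powr p / B powr p))"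
        using pos by (simp add: powr_divide)
      finally show ?thesis .
    qed
    have "(\<Sum>n<K. cmod ((x + y) n) powr p) \<le> (\<Sum>n<K. (A + B) powr p *
        (t * (cmod (x n) powr p / A powr p) + (1 - t) * (cmod (y n) powr p / B powr p)))"
      by (rule sum_mono) (rule le)
    also have "\<dots> = (A + B) powr p * (t * ((\<Sum>n<K. cmod (x n) powr p) / A powr p)
        + (1 - t) * ((\<Sum>n<K. cmod (y n) powr p) / B powr p))"
      by (simp only: sum_distrib_left[symmetric] sum.distrib sum_divide_distrib[symmetric])
    also have "\<dots> \<le> (A + B) powr p * (t * 1 + (1 - t) * 1)"
    proof -
      have "(\<Sum>n<K. cmod (x n) powr p) \<le> A powr p"
        using lp_sum_le[OF p x, of K] powr_mono2[of p ?a A] A p lp_norm_nonneg[of p x] by linarith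
      moreover have "(\<Sum>n<K. cmod (y n) powr p) \<le> B powr p"
        using lp_sum_le[OF p y, of K] powr_mono2[of p ?b B] B p lp_norm_nonneg[of p y] by linarith
      ultimately show ?thesis using pos t(1,2) by (intro mult_left_mono add_mono) auto
    qed
    finally show ?thesis by simp
  qed
  have z: "(x + y) 0 = 0" using x y by (simp add: lp_space_def)
  have bd: "x + y \<in> lp_space p \<and> lp_norm p (x + y) \<le> (?a + e) + (?b + e)" if "e > 0" for e
    using lp_normI[of p "x + y", OF p z _ key[of "?a + e" "?b + e"]] that
      lp_norm_nonneg[of p x] lp_norm_nonneg[of p y] by simp
  show "x + y \<in> lp_space p" using bd[of 1] by simp
  show "lp_norm p (x + y) \<le> ?a + ?b"
  proof (rule field_le_epsilon)
    fix e :: real assume "e > 0"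
    then show "lp_norm p (x + y) \<le> ?a + ?b + e" using bd[of "e / 2"] by simp
  qed
qed

lemma lp_coord_le:
  assumes "p \<ge> 1" "x \<in> lp_space p"
  shows "cmod (x n) \<le> lp_norm p x"
proof (rule ccontr)
  assume "\<not> ?thesis"
  then have "lp_norm p x powr p < cmod (x n) powr p"
    using assms lp_norm_nonneg by (intro powr_less_mono2) auto
  also have "\<dots> \<le> (\<Sum>i<Suc n. cmod (x i) powr p)" by (simp add: sum_nonneg)
  finally show False using lp_sum_le[OF assms, of "Suc n"] by simp
qed

lemma lp_norm_mono:
  assumes "p \<ge> 1" "x \<in> lp_space p" "\<And>n. cmod (y n) \<le> cmod (x n)"
  shows "y \<in> lp_space p" "lp_norm p y \<le> lp_norm p x"
proof -
  have "y 0 = 0" using assms(3)[of 0] assms(2) by (simp add: lp_space_def)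
  moreover have "(\<Sum>n<K. cmod (y n) powr p) \<le> lp_norm p x powr p" for K
  proof -
    have "(\<Sum>n<K. cmod (y n) powr p) \<le> (\<Sum>n<K. cmod (x n) powr p)"
      using assms by (intro sum_mono powr_mono2) auto
    then show ?thesis using lp_sum_le[OF assms(1,2), of K] by linarith
  qed
  ultimately show "y \<in> lp_space p" "lp_norm p y \<le> lp_norm p x"
    using lp_normI[OF assms(1), of y "lp_norm p x"] lp_norm_nonneg by blast+
qed

lemma lp_shift:
  assumes p: "p \<ge> 1" and x: "x \<in> lp_space p"
  shows "back_shift m x \<in> lp_space p" "lp_norm p (back_shift m x) = lp_norm p (seq_tail m x)"
proof -
  let ?f = "\<lambda>n. cmod (seq_tail m x n) powr p"
  have t: "seq_tail m x \<in> lp_space p"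
    by (rule lp_norm_mono(1)[OF p x]) (auto simp: seq_tail_def)
  then have s: "summable ?f" by (simp add: lp_space_def)
  have eq: "cmod (back_shift m x n) powr p = ?f (n + m)" for n
    by (simp add: back_shift_def seq_tail_def)
  have s': "summable (\<lambda>n. ?f (n + m))" by (rule summable_ignore_initial_segment[OF s])
  have "summable (\<lambda>n. cmod (back_shift m x n) powr p)" unfolding eq by (rule s')
  then show "back_shift m x \<in> lp_space p" by (simp add: lp_space_def back_shift_def)
  have "(\<Sum>n. ?f n) = (\<Sum>n. ?f (n + m)) + (\<Sum>i<m. ?f i)"
    by (rule suminf_split_initial_segment[OF s])
  also have "(\<Sum>i<m. ?f i) = 0" by (simp add: seq_tail_def)
  finally show "lp_norm p (back_shift m x) = lp_norm p (seq_tail m x)"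
    unfolding lp_norm_def eq by simp
qed

lemma lp_tail_tendsto:
  assumes p: "p \<ge> 1" and x: "x \<in> lp_space p"
  shows "(\<lambda>m. lp_norm p (seq_tail m x)) \<longlonglongrightarrow> 0"
proof -
  let ?f = "\<lambda>n. cmod (x n) powr p"
  have s: "summable ?f" using x by (simp add: lp_space_def)
  have eq: "lp_norm p (seq_tail m x) = (\<Sum>n. ?f (n + Suc m)) powr (1 / p)" for m
  proof -
    let ?g = "\<lambda>n. cmod (seq_tail m x n) powr p"
    have "summable ?g" using lp_norm_mono(1)[OF p x, of "seq_tail m x"]
      by (auto simp: seq_tail_def lp_space_def)
    then have "(\<Sum>n. ?g n) = (\<Sum>n. ?g (n + Suc m)) + (\<Sum>i<Suc m. ?g i)"
      by (rule suminf_split_initial_segment)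
    also have "(\<Sum>i<Suc m. ?g i) = 0" by (rule sum.neutral) (simp add: seq_tail_def)
    also have "(\<lambda>n. ?g (n + Suc m)) = (\<lambda>n. ?f (n + Suc m))" by (simp add: seq_tail_def)
    finally show ?thesis by (simp add: lp_norm_def)
  qed
  have "(\<lambda>m. \<Sum>n. ?f (n + m)) \<longlonglongrightarrow> 0" by (rule suminf_exist_split2[OF s])
  then have "(\<lambda>m. \<Sum>n. ?f (n + Suc m)) \<longlonglongrightarrow> 0" by (rule LIMSEQ_Suc)
  moreover have "0 \<le> (\<Sum>n. ?f (n + Suc m))" for m
    using summable_ignore_initial_segment[OF s, of "Suc m"] by (intro suminf_nonneg) auto
  ultimately have "(\<lambda>m. (\<Sum>n. ?f (n + Suc m)) powr (1 / p)) \<longlonglongrightarrow> 0 powr (1 / p)"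
    using p by (intro tendsto_powr2) auto
  then show ?thesis by (simp add: eq)
qed

lemma solid_seq_space_lp:
  assumes p: "p \<ge> 1"
  shows "solid_seq_space (lp_space p) (lp_norm p)"
proof
  fix x y :: "nat \<Rightarrow> complex" and c :: complex and n m :: nat
  show "lp_norm p (unit_seq n) \<le> 1" "unit_seq n \<in> lp_space p"
  proof -
    have "(\<Sum>i<K. cmod (unit_seq n i) powr p) \<le> 1 powr p" for K
    proof -
      have "(\<Sum>i<K. cmod (unit_seq n i) powr p) \<le> (\<Sum>i<K. if i = n then 1 else 0)"
        by (rule sum_mono) (auto simp: unit_seq_def)
      also have "\<dots> \<le> 1 powr p" by simp
      finally show ?thesis .
    qed
    moreover have "unit_seq n 0 = 0" by (auto simp: unit_seq_def)
    ultimately show "unit_seq n \<in> lp_space p" "lp_norm p (unit_seq n) \<le> 1"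
      using lp_normI[OF p, of "unit_seq n" 1] by auto
  qed
  assume x: "x \<in> lp_space p"
  show "x 0 = 0" using x by (simp add: lp_space_def)
  show "cscale c x \<in> lp_space p" "lp_norm p (cscale c x) = cmod c * lp_norm p x"
  proof -
    have s: "summable (\<lambda>n. cmod (x n) powr p)" using x by (simp add: lp_space_def)
    have eq: "cmod (cscale c x n) powr p = cmod c powr p * cmod (x n) powr p" for n
      by (simp add: cscale_def norm_mult powr_mult)
    show "cscale c x \<in> lp_space p"
      using s x unfolding lp_space_def mem_Collect_eq eq
      by (auto simp: cscale_def intro: summable_mult)
    show "lp_norm p (cscale c x) = cmod c * lp_norm p x"
      unfolding lp_norm_def eq using p suminf_nonneg[OF s]
      by (simp add: suminf_mult[OF s] powr_mult powr_powr)
  qed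
qed (use p lp_minkowski lp_coord_le lp_norm_mono lp_shift lp_tail_tendsto in auto)

lemma banach_seq_space_lp:
  assumes p: "p \<ge> 1"
  shows "banach_seq_space (lp_space p) (lp_norm p)"
proof -
  interpret solid_seq_space "lp_space p" "lp_norm p" by (rule solid_seq_space_lp[OF p])
  show ?thesis
  proof
    fix u :: "nat \<Rightarrow> nat \<Rightarrow> complex"
    assume u: "\<And>i. u i \<in> lp_space p" and s: "summable (\<lambda>i. lp_norm p (u i))"
    let ?C = "\<Sum>i. lp_norm p (u i)"
    have C: "?C \<ge> 0" using s lp_norm_nonneg by (intro suminf_nonneg) auto
    \<comment> \<open>With \<open>K\<close> coordinates fixed, the bound for partial sums of the
      series survives the limit in \<open>I\<close>.\<close>
    have "(\<Sum>n<K. cmod (\<Sum>i. u i n) powr p) \<le> ?C powr p" for K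
    proof (rule LIMSEQ_le_const2)
      show "(\<lambda>I. \<Sum>n<K. cmod (\<Sum>i<I. u i n) powr p) \<longlonglongrightarrow> (\<Sum>n<K. cmod (\<Sum>i. u i n) powr p)"
        using p by (intro tendsto_sum tendsto_powr2 tendsto_norm summable_LIMSEQ summable_coord u s) auto
      have "(\<Sum>n<K. cmod (\<Sum>i<I. u i n) powr p) \<le> ?C powr p" for I
      proof -
        have "(\<Sum>n<K. cmod (\<Sum>i<I. u i n) powr p) \<le> lp_norm p (\<lambda>n. \<Sum>i<I. u i n) powr p"
          by (rule lp_sum_le[OF p]) (intro sum_in u)
        also have "\<dots> \<le> (\<Sum>i<I. lp_norm p (u i)) powr p"
          using p by (intro powr_mono2 norm_sum_le u) (auto simp: lp_norm_nonneg)
        also have "\<dots> \<le> ?C powr p"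
          using p lp_norm_nonneg by (intro powr_mono2 sum_le_suminf s sum_nonneg) auto
        finally show ?thesis .
      qed
      then show "\<exists>N. \<forall>n\<ge>N. (\<Sum>na<K. cmod (\<Sum>i<n. u i na) powr p) \<le> ?C powr p" by blast
    qed
    moreover have "(\<Sum>i. u i 0) = 0" using u by (simp add: coord_0)
    ultimately show "(\<lambda>m. \<Sum>i. u i m) \<in> lp_space p" "lp_norm p (\<lambda>m. \<Sum>i. u i m) \<le> ?C"
      using lp_normI[OF p, of "\<lambda>m. \<Sum>i. u i m" ?C] C by auto
  qed
qed

section \<open>The space of null sequences\<close>

lemma c0_coord_le:
  assumes "x \<in> c0_space"
  shows "cmod (x n) \<le> c0_norm x"
proof -
  have "Bseq x" using assms by (auto simp: c0_space_def intro: convergent_imp_Bseq convergentI)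
  then have "bdd_above (range (\<lambda>n. cmod (x n)))" by (auto simp: Bseq_def bdd_above_def)
  then show ?thesis unfolding c0_norm_def by (intro cSUP_upper) auto
qed

lemma c0_norm_le: "(\<And>n. cmod (x n) \<le> C) \<Longrightarrow> c0_norm x \<le> C"
  unfolding c0_norm_def by (intro cSUP_least) auto

lemma c0_solid:
  assumes "x \<in> c0_space" "\<And>n. cmod (y n) \<le> cmod (x n)"
  shows "y \<in> c0_space"
proof -
  have "x \<longlonglongrightarrow> 0" using assms by (simp add: c0_space_def)
  then have "y \<longlonglongrightarrow> 0" by (rule Lim_null_comparison[rotated, OF tendsto_norm_zero]) (use assms in auto)
  then show ?thesis using assms(2)[of 0] assms(1) by (simp add: c0_space_def)
qed

lemma solid_seq_space_c0: "solid_seq_space c0_space c0_norm"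
proof
  fix x y :: "nat \<Rightarrow> complex" and c :: complex and n m :: nat
  have "unit_seq n \<longlonglongrightarrow> 0"
    by (rule tendsto_eventually, rule eventually_sequentiallyI[of "Suc n"]) (simp add: unit_seq_def)
  moreover have "unit_seq n 0 = 0" by (auto simp: unit_seq_def)
  ultimately show "unit_seq n \<in> c0_space" by (simp add: c0_space_def)
  show "c0_norm (unit_seq n) \<le> 1" by (rule c0_norm_le) (simp add: unit_seq_def)
  assume x: "x \<in> c0_space"
  show x0: "x 0 = 0" using x by (simp add: c0_space_def)
  show "cmod (x n) \<le> c0_norm x" by (rule c0_coord_le[OF x])
  show sc: "cscale c x \<in> c0_space"
    using x by (auto simp: c0_space_def cscale_def intro: tendsto_mult_right_zero)
  show "c0_norm (cscale c x) = cmod c * c0_norm x"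
  proof (rule antisym)
    show "c0_norm (cscale c x) \<le> cmod c * c0_norm x"
      by (rule c0_norm_le) (simp add: cscale_def norm_mult mult_left_mono c0_coord_le x)
    show "cmod c * c0_norm x \<le> c0_norm (cscale c x)"
    proof (cases "c = 0")
      case True
      then show ?thesis using order_trans[OF norm_ge_zero c0_coord_le[OF sc]] by simp
    next
      case False
      have "c0_norm x \<le> c0_norm (cscale c x) / cmod c"
      proof (rule c0_norm_le)
        fix n show "cmod (x n) \<le> c0_norm (cscale c x) / cmod c"
          using c0_coord_le[OF sc, of n] False by (simp add: cscale_def norm_mult field_simps)
      qed
      then show ?thesis using False by (simp add: field_simps)
    qed
  qed
  show "y \<in> c0_space" if "\<And>n. cmod (y n) \<le> cmod (x n)" by (rule c0_solid[OF x that])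
  show "c0_norm y \<le> c0_norm x" if "\<And>n. cmod (y n) \<le> cmod (x n)"
    by (rule c0_norm_le) (rule order_trans[OF that c0_coord_le[OF x]])
  have t: "seq_tail m x \<in> c0_space" for m by (rule c0_solid[OF x]) (simp add: seq_tail_def)
  have "(\<lambda>i. x (i + m)) \<longlonglongrightarrow> 0" using x by (simp add: c0_space_def LIMSEQ_ignore_initial_segment)
  then have "back_shift m x \<longlonglongrightarrow> 0"
    by (rule Lim_transform_eventually)
       (rule eventually_sequentiallyI[of 1], simp add: back_shift_def)
  then show b: "back_shift m x \<in> c0_space" by (simp add: c0_space_def back_shift_def)
  show "c0_norm (back_shift m x) = c0_norm (seq_tail m x)"
  proof (rule antisym)
    show "c0_norm (back_shift m x) \<le> c0_norm (seq_tail m x)"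
    proof (rule c0_norm_le)
      fix n show "cmod (back_shift m x n) \<le> c0_norm (seq_tail m x)"
        using c0_coord_le[OF t[of m], of "n + m"] c0_coord_le[OF t[of m], of 0] x0
        by (auto simp: back_shift_def seq_tail_def)
    qed
    show "c0_norm (seq_tail m x) \<le> c0_norm (back_shift m x)"
    proof (rule c0_norm_le)
      fix n show "cmod (seq_tail m x n) \<le> c0_norm (back_shift m x)"
        using c0_coord_le[OF b, of "n - m"] c0_coord_le[OF b, of 0]
        by (auto simp: back_shift_def seq_tail_def split: if_splits)
    qed
  qed
  show "(\<lambda>m. c0_norm (seq_tail m x)) \<longlonglongrightarrow> 0"
  proof (rule LIMSEQ_I)
    fix r :: real assume r: "r > 0"
    from x have "x \<longlonglongrightarrow> 0" by (simp add: c0_space_def)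
    from LIMSEQ_D[OF this, of "r / 2"] r obtain M where M: "\<And>n. n \<ge> M \<Longrightarrow> cmod (x n) < r / 2" by auto
    have "norm (c0_norm (seq_tail m x) - 0) < r" if "m \<ge> M" for m
    proof -
      have "c0_norm (seq_tail m x) \<le> r / 2"
        by (rule c0_norm_le) (use r M that in \<open>auto simp: seq_tail_def less_imp_le\<close>)
      moreover have "0 \<le> c0_norm (seq_tail m x)"
        using order_trans[OF norm_ge_zero c0_coord_le[OF t]] .
      ultimately show ?thesis using r by simp
    qed
    then show "\<exists>no. \<forall>m\<ge>no. norm (c0_norm (seq_tail m x) - 0) < r" by blast
  qed
  assume y: "y \<in> c0_space"
  show "x + y \<in> c0_space" using x y tendsto_add[of x 0 sequentially y 0]
    by (auto simp: c0_space_def plus_fun_def)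
  show "c0_norm (x + y) \<le> c0_norm x + c0_norm y"
    by (rule c0_norm_le) (auto intro!: norm_triangle_le add_mono c0_coord_le x y)
qed

lemma banach_seq_space_c0: "banach_seq_space c0_space c0_norm"
proof -
  interpret solid_seq_space c0_space c0_norm by (rule solid_seq_space_c0)
  show ?thesis
  proof
    fix u :: "nat \<Rightarrow> nat \<Rightarrow> complex"
    assume u: "\<And>i. u i \<in> c0_space" and s: "summable (\<lambda>i. c0_norm (u i))"
    let ?C = "\<Sum>i. c0_norm (u i)"
    have sm: "summable (\<lambda>i. cmod (u i m))" for m
      by (rule summable_comparison_test'[OF s, of 0]) (use c0_coord_le u in auto)
    have rest: "cmod (\<Sum>i. u (i + I) m) \<le> (\<Sum>i. c0_norm (u (i + I)))" for I m
    proof -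
      have s1: "summable (\<lambda>i. cmod (u (i + I) m))" by (rule summable_ignore_initial_segment[OF sm])
      have s2: "summable (\<lambda>i. c0_norm (u (i + I)))" by (rule summable_ignore_initial_segment[OF s])
      have "cmod (\<Sum>i. u (i + I) m) \<le> (\<Sum>i. cmod (u (i + I) m))" by (rule summable_norm[OF s1])
      also have "\<dots> \<le> (\<Sum>i. c0_norm (u (i + I)))"
        by (rule suminf_le[OF _ s1 s2]) (simp add: c0_coord_le u)
      finally show ?thesis .
    qed
    show "c0_norm (\<lambda>m. \<Sum>i. u i m) \<le> ?C"
      using rest[of 0] by (intro c0_norm_le) simp
    have "(\<lambda>m. \<Sum>i. u i m) \<longlonglongrightarrow> 0"
    proof (rule LIMSEQ_I)
      fix r :: real assume r: "r > 0"
      \<comment> \<open>The remainder beyond \<open>I\<close> is small uniformly in the coordinate;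
        the finite sum before it is a null sequence.\<close>
      from suminf_exist_split[OF half_gt_zero[OF r] s]
      obtain I where I: "norm (\<Sum>i. c0_norm (u (i + I))) < r / 2" by blast
      have "(\<lambda>m. \<Sum>i<I. u i m) \<longlonglongrightarrow> 0"
        using u by (intro tendsto_null_sum) (auto simp: c0_space_def)
      from LIMSEQ_D[OF this half_gt_zero[OF r]]
      obtain M where M: "\<And>m. m \<ge> M \<Longrightarrow> cmod (\<Sum>i<I. u i m) < r / 2" by auto
      have "cmod (\<Sum>i. u i m) < r" if "m \<ge> M" for m
      proof -
        have "(\<Sum>i. u i m) = (\<Sum>i. u (i + I) m) + (\<Sum>i<I. u i m)"
          by (rule suminf_split_initial_segment[OF summable_norm_cancel[OF sm]])
        then have "cmod (\<Sum>i. u i m) \<le> cmod (\<Sum>i. u (i + I) m) + cmod (\<Sum>i<I. u i m)"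
          by (simp add: norm_triangle_ineq)
        then show ?thesis using rest[of I m] I M[OF that] by simp
      qed
      then show "\<exists>no. \<forall>m\<ge>no. norm ((\<Sum>i. u i m) - 0) < r" by auto
    qed
    then show "(\<lambda>m. \<Sum>i. u i m) \<in> c0_space" using u by (simp add: c0_space_def)
  qed
qed

subsection \<open>Products of weights\<close>

text \<open>The factor with which the n-th power of the shift carries coordinate k + n to coordinate
  k.\<close>

definition weight_prod :: "(nat \<Rightarrow> complex) \<Rightarrow> nat \<Rightarrow> nat \<Rightarrow> complex" where
  "weight_prod w k n = (\<Prod>\<nu>=1..n. w (\<nu> + k))"

lemma weight_prod_0 [simp]: "weight_prod w k 0 = 1"
  by (simp add: weight_prod_def)

lemma weight_prod_add: "weight_prod w k (m + n) = weight_prod w k m * weight_prod w (k + m) n"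
proof -
  have "(\<Prod>\<nu>=1..m + n. w (\<nu> + k)) = (\<Prod>\<nu>=1..m. w (\<nu> + k)) * (\<Prod>\<nu>=m+1..m+n. w (\<nu> + k))"
    by (rule prod.ub_add_nat) simp
  also have "(\<Prod>\<nu>=m+1..m+n. w (\<nu> + k)) = (\<Prod>\<nu>=1..n. w (\<nu> + (k + m)))"
    using prod.shift_bounds_cl_nat_ivl[of "\<lambda>\<nu>. w (\<nu> + k)" 1 m n] by (simp add: add_ac)
  finally show ?thesis by (simp add: weight_prod_def)
qed

lemma weight_prod_Suc: "weight_prod w k (Suc n) = w (Suc k) * weight_prod w (Suc k) n"
  using weight_prod_add[of w k 1 n] by (simp add: weight_prod_def)

text \<open>The bound starts at index 2 because the shift sends the first basis vector to 0, so its
  norm does not see \<open>w 1\<close>. Taking \<open>M\<close> at least 1 makes its powers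
  increasing.\<close>

locale bounded_weights =
  fixes w :: "nat \<Rightarrow> complex" and M :: real
  assumes weight_nonzero: "n \<ge> 1 \<Longrightarrow> w n \<noteq> 0"
    and weight_le: "n \<ge> 2 \<Longrightarrow> cmod (w n) \<le> M"
    and one_le_bound: "1 \<le> M"
begin

lemma weight_prod_nonzero: "weight_prod w k n \<noteq> 0"
  by (auto simp: weight_prod_def weight_nonzero)

lemma weight_prod_le: "k \<ge> 1 \<Longrightarrow> cmod (weight_prod w k n) \<le> M ^ n"
proof (induction n arbitrary: k)
  case (Suc n)
  have "cmod (w (Suc k)) * cmod (weight_prod w (Suc k) n) \<le> M * M ^ n"
    using Suc one_le_bound by (intro mult_mono weight_le) auto
  then show ?case by (simp add: weight_prod_Suc norm_mult)
qed simp

text \<open>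
  If from every index beyond \<open>K\<close> some backward product of length at most \<open>n0\<close> exceeds \<open>2\<close>, then
  chaining such products downwards from \<open>k + n\<close> overshoots \<open>k\<close> by less than \<open>n0\<close> factors.
\<close>
lemma weight_prod_chain:
  assumes big: "\<And>k. k \<ge> K \<Longrightarrow> \<exists>n\<le>n0. 2 < cmod (weight_prod w (k - n) n)"
    and K: "K > n0" and k: "k \<ge> K"
  shows "2 ^ (n div n0) \<le> M ^ n0 * cmod (weight_prod w k n)"
proof (induction n rule: less_induct)
  case (less n)
  have M1: "1 \<le> M ^ j" for j using one_le_bound by simp
  obtain l where l: "l \<le> n0" "2 < cmod (weight_prod w (k + n - l) l)"
    using big[of "k + n"] k by auto
  then have l0: "0 < l" by (cases l) auto
  show ?case
  proof (cases "l \<le> n")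
    case True
    have split: "weight_prod w k n = weight_prod w k (n - l) * weight_prod w (k + n - l) l"
      using weight_prod_add[of w k "n - l" l] True by simp
    have IH: "2 ^ ((n - l) div n0) \<le> M ^ n0 * cmod (weight_prod w k (n - l))"
      using less.IH[of "n - l"] l0 True by simp
    \<comment> \<open>Removing a block of length \<open>l \<le> n0\<close> lowers the exponent by at
      most one, which the factor 2 of the block compensates.\<close>
    have "n div n0 \<le> Suc ((n - l) div n0)"
    proof -
      have "n div n0 \<le> ((n - l) + n0) div n0" using l True by (intro div_le_mono) linarith
      also have "\<dots> = Suc ((n - l) div n0)" using l l0 by simp
      finally show ?thesis .
    qed
    then have "(2::real) ^ (n div n0) \<le> 2 ^ Suc ((n - l) div n0)" by (intro power_increasing) auto
    also have "\<dots> = 2 ^ ((n - l) div n0) * 2" by simp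
    also have "\<dots> \<le> (M ^ n0 * cmod (weight_prod w k (n - l))) * cmod (weight_prod w (k + n - l) l)"
      using IH l M1[of n0] by (intro mult_mono) auto
    finally show ?thesis by (simp add: split norm_mult mult.assoc)
  next
    case False
    \<comment> \<open>The block starts below \<open>k\<close>; since \<open>K > n0\<close> it still
      starts at an index at least 1, where its surplus factors are bounded by \<open>M\<close>. Here
      n < n0, so the exponent is 0.\<close>
    have "k + n - l + (l - n) = k" using False l K k by linarith
    then have split: "weight_prod w (k + n - l) l = weight_prod w (k + n - l) (l - n) * weight_prod w k n"
      using weight_prod_add[of w "k + n - l" "l - n" n] False by simp
    have "(2::real) ^ (n div n0) \<le> 2" using False l by simp
    also have "\<dots> \<le> cmod (weight_prod w (k + n - l) l)" using l by simp
    also have "\<dots> = cmod (weight_prod w (k + n - l) (l - n)) * cmod (weight_prod w k n)"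
      by (simp add: split norm_mult)
    also have "\<dots> \<le> M ^ (l - n) * cmod (weight_prod w k n)"
      using l K k by (intro mult_right_mono weight_prod_le) auto
    also have "\<dots> \<le> M ^ n0 * cmod (weight_prod w k n)"
      using l one_le_bound by (intro mult_right_mono power_increasing) auto
    finally show ?thesis .
  qed
qed

text \<open>Otherwise \<open>weight_prod_chain\<close> gives exponential growth of all products
  starting far out. A product starting earlier has boundedly many factors before that region, so all
  products of one large length would exceed \<open>C\<close>.\<close>

lemma exists_small_backward_products:
  assumes small: "\<And>n. n \<ge> 1 \<Longrightarrow> \<exists>k\<ge>1. cmod (weight_prod w k n) \<le> C"
  shows "\<exists>k\<ge>K. \<forall>n\<le>n0. cmod (weight_prod w (k - n) n) \<le> 2"
proof (rule ccontr)
  assume "\<not> ?thesis"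
  then have big: "\<exists>n\<le>n0. 2 < cmod (weight_prod w (k - n) n)" if "k \<ge> K" for k
    using that by force
  define K' where "K' = max K (Suc n0)"
  have n0: "n0 > 0"
  proof (rule ccontr)
    assume "\<not> n0 > 0"
    then show False using big[of K] by auto
  qed
  have chain: "2 ^ (n div n0) \<le> M ^ n0 * cmod (weight_prod w k n)" if "k \<ge> K'" for k n
    by (rule weight_prod_chain[where K = K']) (use that big in \<open>auto simp: K'_def\<close>)
  \<comment> \<open>A positive lower bound for the initial pieces from a start \<open>k\<close> up
    to \<open>K'\<close>, of which there are only finitely many.\<close>
  define c where "c = Min (insert 1 ((\<lambda>k. cmod (weight_prod w k (K' - k))) ` {..K'}))"
  have c: "c > 0" "c \<le> 1" "\<And>k. k \<le> K' \<Longrightarrow> c \<le> cmod (weight_prod w k (K' - k))"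
    using weight_prod_nonzero unfolding c_def by (auto intro!: Min_le simp del: Min_insert)
  have M1: "1 \<le> M ^ n0" using one_le_bound by simp
  obtain q where q: "C * M ^ n0 / c < 2 ^ q"
    using real_arch_pow[of 2 "C * M ^ n0 / c"] by auto
  \<comment> \<open>This length leaves at least \<open>n0 * q\<close> factors beyond
    \<open>K'\<close> for every start.\<close>
  define n where "n = K' + n0 * q"
  obtain k where k: "k \<ge> 1" "cmod (weight_prod w k n) \<le> C"
    using small[of n] by (force simp: n_def K'_def)
  have "c * 2 ^ q \<le> M ^ n0 * cmod (weight_prod w k n)"
  proof (cases "k \<ge> K'")
    case True
    have "q \<le> n div n0" using n0 by (simp add: n_def)
    then have "(2::real) ^ q \<le> 2 ^ (n div n0)" by (intro power_increasing) auto
    also have "\<dots> \<le> M ^ n0 * cmod (weight_prod w k n)" by (rule chain[OF True])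
    finally have "1 * 2 ^ q \<le> M ^ n0 * cmod (weight_prod w k n)" by simp
    then show ?thesis by (rule order_trans[OF mult_right_mono, rotated 2]) (use c in auto)
  next
    case False
    have split: "weight_prod w k n = weight_prod w k (K' - k) * weight_prod w K' (k + n0 * q)"
      using weight_prod_add[of w k "K' - k" "k + n0 * q"] False by (simp add: n_def)
    have "q \<le> (k + n0 * q) div n0" using n0 by simp
    then have "(2::real) ^ q \<le> 2 ^ ((k + n0 * q) div n0)" by (intro power_increasing) auto
    also have "\<dots> \<le> M ^ n0 * cmod (weight_prod w K' (k + n0 * q))" by (rule chain) simp
    finally have "c * 2 ^ q \<le> cmod (weight_prod w k (K' - k)) * (M ^ n0 * cmod (weight_prod w K' (k + n0 * q)))"
      using c False by (intro mult_mono) auto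
    then show ?thesis by (simp add: split norm_mult mult_ac)
  qed
  also have "\<dots> \<le> M ^ n0 * C" using k M1 by (intro mult_left_mono) auto
  finally show False using q c by (simp add: field_simps)
qed

text \<open>The n div n0 complete blocks contribute at least \<open>a\<close> each. The r < n0
  remaining factors cannot be too small: completing them to a block of product at least 1 multiplies
  by at most \<open>M ^ n0\<close>.\<close>

lemma weight_prod_exp_growth:
  assumes n0: "n0 \<ge> 1" and a: "a \<ge> 1"
    and ge: "\<And>k. k \<ge> 1 \<Longrightarrow> a \<le> cmod (weight_prod w k n0)" and k: "k \<ge> 1"
  shows "a ^ (n div n0) \<le> M ^ n0 * cmod (weight_prod w k n)"
proof -
  have mult: "a ^ q \<le> cmod (weight_prod w k (n0 * q))" if "k \<ge> 1" for k q
    using that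
  proof (induction q arbitrary: k)
    case (Suc q)
    have "a * a ^ q \<le> cmod (weight_prod w k n0) * cmod (weight_prod w (k + n0) (n0 * q))"
      using Suc a ge by (intro mult_mono) auto
    then show ?case using weight_prod_add[of w k n0 "n0 * q"] by (simp add: norm_mult)
  qed simp
  define q r where "q = n div n0" and "r = n mod n0"
  have n: "n = n0 * q + r" "r < n0" using n0 by (auto simp: q_def r_def)
  let ?j = "k + n0 * q"
  have "1 \<le> cmod (weight_prod w ?j n0)" using a ge[of ?j] k by linarith
  also have "\<dots> = cmod (weight_prod w ?j r) * cmod (weight_prod w (?j + r) (n0 - r))"
    using weight_prod_add[of w ?j r "n0 - r"] n by (simp add: norm_mult)
  also have "\<dots> \<le> cmod (weight_prod w ?j r) * M ^ (n0 - r)"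
    using k by (intro mult_left_mono weight_prod_le) auto
  also have "\<dots> \<le> cmod (weight_prod w ?j r) * M ^ n0"
    using one_le_bound by (intro mult_left_mono power_increasing) auto
  finally have "a ^ q * 1 \<le> cmod (weight_prod w k (n0 * q)) * (cmod (weight_prod w ?j r) * M ^ n0)"
    using mult[OF k, of q] a by (intro mult_mono) auto
  then show ?thesis
    using weight_prod_add[of w k "n0 * q" r] n by (simp add: norm_mult q_def[symmetric] mult_ac)
qed

end

subsection \<open>Vectors with slowly decaying tails\<close>

text \<open>Each further condition that a coordinate vanish lowers the dimension by at most one: one
  vector \<open>v\<close> with \<open>v m \<noteq> 0\<close> spans a complement, since a multiple of
  it cancels coordinate \<open>m\<close> of any other vector.\<close>

lemma exists_nonzero_vanishing_initially:
  assumes V: "cseq.subspace V" and inf: "infinite_dimensional V"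
  shows "\<exists>x\<in>V. x \<noteq> 0 \<and> (\<forall>i<m. x i = 0)"
proof -
  let ?U = "\<lambda>m::nat. {x \<in> V. \<forall>i<m. x i = 0}"
  have "infinite_dimensional (?U m)"
  proof (induction m)
    case 0
    then show ?case using inf by simp
  next
    case (Suc m)
    show ?case
      unfolding infinite_dimensional_def
    proof
      assume "\<exists>S. finite S \<and> ?U (Suc m) \<subseteq> cseq.span S"
      then obtain S where S: "finite S" "?U (Suc m) \<subseteq> cseq.span S" by blast
      have "\<exists>S. finite S \<and> ?U m \<subseteq> cseq.span S"
      proof (cases "\<exists>v\<in>?U m. v m \<noteq> 0")
        case False
        then have "?U m \<subseteq> ?U (Suc m)" by (auto simp: less_Suc_eq)
        then have "?U m \<subseteq> cseq.span S" using S(2) by (rule order_trans)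
        then show ?thesis using S(1) by (intro exI[of _ S] conjI)
      next
        case True
        then obtain v where v: "v \<in> V" "\<And>i. i < m \<Longrightarrow> v i = 0" "v m \<noteq> 0" by blast
        have "x \<in> cseq.span (insert v S)" if x: "x \<in> ?U m" for x
        proof -
          let ?y = "x - cscale (x m / v m) v"
          have "?y \<in> V" using x v V by (intro cseq.subspace_diff cseq.subspace_scale) auto
          moreover have "\<forall>i<Suc m. ?y i = 0" using x v by (simp add: cscale_def less_Suc_eq)
          ultimately have "?y \<in> ?U (Suc m)" by blast
          then have "?y \<in> cseq.span (insert v S)"
            using S(2) cseq.span_mono[of S "insert v S"] by blast
          moreover have "cscale (x m / v m) v \<in> cseq.span (insert v S)"
            by (intro cseq.span_scale cseq.span_base) simp
          ultimately have "?y + cscale (x m / v m) v \<in> cseq.span (insert v S)"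
            by (rule cseq.span_add)
          then show ?thesis by simp
        qed
        then have "?U m \<subseteq> cseq.span (insert v S)" by blast
        then show ?thesis using S(1) by (meson finite_insert)
      qed
      then show False using Suc by (simp add: infinite_dimensional_def)
    qed
  qed
  then have "\<not> ?U m \<subseteq> cseq.span {}" unfolding infinite_dimensional_def by blast
  then obtain x where "x \<in> ?U m" "x \<noteq> 0" unfolding cseq.span_empty by blast
  then show ?thesis by blast
qed

lemma seq_tail_add: "seq_tail m (x + y) = seq_tail m x + seq_tail m y"
  by (simp add: seq_tail_def fun_eq_iff)

context banach_seq_space
begin

text \<open>
  The witness is \<open>\<Sum>j. 4\<^sup>-\<^sup>j x\<^sub>j\<close> with unit vectors \<open>x\<^sub>j\<close> of \<open>V\<close> that vanish up to a rapidly
  increasing index \<open>K\<^sub>j\<close>: up to \<open>K\<^sub>j\<close> the tails are dominated by the \<open>j\<close>-th term.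
\<close>
lemma exists_slow_tails:
  assumes VX: "V \<subseteq> X" and V: "cseq.subspace V" and closed: "closedin (norm_topology X N) V"
    and inf: "infinite_dimensional V" and \<delta>: "\<delta> \<longlonglongrightarrow> (0::real)"
  shows "\<exists>x\<in>V. \<exists>m0. \<forall>m\<ge>m0. \<delta> m \<le> N (seq_tail m x)"
proof -
  \<comment> \<open>With ratio 1/4 all terms after the j-th have total norm at most
    \<open>e j / 3\<close>. Subtracting also \<open>e j / 4\<close> for the tail of the earlier
    terms leaves 5/12 of \<open>e j\<close>, more than the required quarter.\<close>
  define e :: "nat \<Rightarrow> real" where "e j = (1 / 4) ^ j" for j
  have e_pos: "e j > 0" for j by (simp add: e_def)
  have "\<exists>m0. \<forall>m\<ge>m0. \<delta> m \<le> e j / 4" for j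
  proof -
    have "\<forall>\<^sub>F m in sequentially. \<delta> m < e j / 4"
      using e_pos by (intro order_tendstoD(2)[OF \<delta>]) simp
    then show ?thesis unfolding eventually_sequentially by (meson less_imp_le)
  qed
  then obtain md where md: "\<And>j m. m \<ge> md j \<Longrightarrow> \<delta> m \<le> e j / 4" by metis
  \<comment> \<open>The bound \<open>md (Suc j) \<le> K\<close> prepares the next stage, which
    serves the indices just beyond \<open>K\<close>; \<open>j \<le> K\<close> makes the indices
    unbounded. \<open>y\<close> is the partial sum built so far.\<close>
  define good where "good j y x K \<longleftrightarrow> x \<in> V \<and> N x = 1 \<and> (\<forall>i\<le>K. x i = 0) \<and> j \<le> K \<and> md (Suc j) \<le> K
      \<and> N (seq_tail K y) \<le> e j / 4" for j y x and K :: nat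
  have ex_good: "\<exists>x K. good j y x K" if y: "y \<in> V" for j y
  proof -
    have "\<forall>\<^sub>F m in sequentially. N (seq_tail m y) < e j / 4"
      using e_pos y VX by (intro order_tendstoD(2)[OF tail_tendsto]) auto
    then obtain K0 where K0: "\<And>m. m \<ge> K0 \<Longrightarrow> N (seq_tail m y) < e j / 4"
      unfolding eventually_sequentially by blast
    define K where "K = max K0 (max j (md (Suc j)))"
    obtain v where v: "v \<in> V" "v \<noteq> 0" "\<And>i. i < Suc K \<Longrightarrow> v i = 0"
      using exists_nonzero_vanishing_initially[OF V inf, of "Suc K"] by auto
    have vX: "v \<in> X" using v VX by blast
    then have Nv: "N v > 0" using norm_nonneg[of v] norm_eq_0[of v] v(2) by simp
    let ?x = "cscale (1 / complex_of_real (N v)) v"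
    have "N ?x = 1" using Nv by (simp add: norm_scale[OF vX] norm_divide)
    moreover have "?x \<in> V" using V v by (intro cseq.subspace_scale)
    moreover have "\<forall>i\<le>K. ?x i = 0" using v(3) by (simp add: cscale_def)
    ultimately have "good j y ?x K" using K0[of K] by (auto simp: good_def K_def)
    then show ?thesis by blast
  qed
  define P where "P j s \<longleftrightarrow> (case s of (y, x, K) \<Rightarrow> (j = 0 \<longrightarrow> y = 0) \<and> y \<in> V \<and> good j y x K)" for j s
  define Q where "Q j s s' \<longleftrightarrow> (case s of (y, x, K) \<Rightarrow> fst s' = y + cscale (e j) x)" for j and s s' :: "(nat \<Rightarrow> complex) \<times> (nat \<Rightarrow> complex) \<times> nat"
  have "\<exists>f. \<forall>j. P j (f j) \<and> Q j (f j) (f (Suc j))"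
  proof (rule dependent_nat_choice)
    have "0 \<in> V" using V by (rule cseq.subspace_0)
    then show "\<exists>s. P 0 s" using ex_good[of 0 0] by (auto simp: P_def)
  next
    fix s j assume "P j s"
    obtain y x K where s: "s = (y, x, K)" by (cases s)
    with \<open>P j s\<close> have "y \<in> V" "x \<in> V" by (auto simp: P_def good_def)
    then have y': "y + cscale (e j) x \<in> V" using V by (intro cseq.subspace_add cseq.subspace_scale)
    then obtain x' K' where "good (Suc j) (y + cscale (e j) x) x' K'" using ex_good by blast
    then have "P (Suc j) (y + cscale (e j) x, x', K') \<and> Q j s (y + cscale (e j) x, x', K')"
      using y' by (simp add: P_def Q_def s)
    then show "\<exists>s'. P (Suc j) s' \<and> Q j s s'" by blast
  qed
  then obtain f where f: "\<And>j. P j (f j)" "\<And>j. Q j (f j) (f (Suc j))" by blast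
  define y x K where "y j = fst (f j)" and "x j = fst (snd (f j))" and "K j = snd (snd (f j))" for j
  have y0: "y 0 = 0"
    using f(1)[of 0] by (simp add: P_def y_def case_prod_unfold)
  have yV: "y j \<in> V" and good: "good j (y j) (x j) (K j)" for j
    using f(1)[of j] by (simp_all add: P_def y_def x_def K_def case_prod_unfold)
  have ySuc: "y (Suc j) = y j + cscale (e j) (x j)" for j
    using f(2)[of j] by (simp add: Q_def y_def x_def case_prod_unfold)
  have xV: "x j \<in> V" and Nx: "N (x j) = 1" for j using good[of j] by (auto simp: good_def)
  define u where "u j = cscale (e j) (x j)" for j
  have uX: "u j \<in> X" for j using xV VX scale_in by (auto simp: u_def)
  have Nu: "N (u j) = e j" for j
    using norm_scale[OF subsetD[OF VX xV[of j]], of "complex_of_real (e j)"] Nx[of j] e_pos[of j]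
    by (simp add: u_def)
  have geo: "(\<lambda>i. e (i + j)) sums (4 / 3 * e j)" for j
  proof -
    have "(\<lambda>i. (1 / 4) ^ i * e j) sums (1 / (1 - 1 / 4) * e j)"
      by (intro sums_mult2 geometric_sums) simp
    then show ?thesis by (simp add: e_def power_add)
  qed
  define r where "r j = (\<lambda>m. \<Sum>i. u (i + j) m)" for j
  have rX: "r j \<in> X" and Nr: "N (r j) \<le> 4 / 3 * e j" for j
    using series_in[of "\<lambda>i. u (i + j)"] norm_series[of "\<lambda>i. u (i + j)"] uX Nu
      sums_summable[OF geo[of j]] sums_unique[OF geo[of j]] by (auto simp: r_def)
  have su: "summable (\<lambda>i. u i m)" for m
    using summable_coord[of u] uX Nu sums_summable[OF geo[of 0]] by simp
  have y_eq: "y j = (\<lambda>m. \<Sum>i<j. u i m)" for j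
    by (induction j) (simp_all add: y0 ySuc u_def fun_eq_iff)
  have split: "r 0 = y j + r j" for j
  proof
    fix m
    show "r 0 m = (y j + r j) m"
      using suminf_split_initial_segment[OF su, of m j] by (simp add: r_def y_eq)
  qed
  have yX: "y j \<in> X" for j using yV VX by blast
  have "r 0 \<in> V"
  proof -
    have "\<exists>v\<in>V. N (v - r 0) < a" if a: "a > 0" for a
    proof -
      obtain j where j: "(1 / 4) ^ j < 3 / 4 * a" using real_arch_pow_inv[of "3 / 4 * a" "1 / 4"] a by auto
      have "N (y j - r 0) = N (r 0 - y j)" by (rule norm_minus_commute) (rule yX rX)+
      also have "r 0 - y j = r j" using split[of j] by simp
      also have "N (r j) < a" using Nr[of j] j by (simp add: e_def)
      finally show ?thesis using yV by blast
    qed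
    then show ?thesis using closed closedin_iff[OF VX] rX by blast
  qed
  moreover have "\<delta> m \<le> N (seq_tail m (r 0))" if m: "m \<ge> md 0" for m
  proof -
    \<comment> \<open>By minimality \<open>m\<close> lies beyond the previous index, which is at
      least \<open>md j\<close>.\<close>
    define j where "j = (LEAST j. m \<le> K j)"
    have Kj: "j \<le> K j" for j using good[of j] by (simp add: good_def)
    have mK: "m \<le> K j" unfolding j_def by (rule LeastI[of _ m]) (rule Kj)
    have "m \<ge> md j"
    proof (cases j)
      case 0
      then show ?thesis using m by simp
    next
      case (Suc i)
      then have "\<not> m \<le> K i" unfolding j_def using not_less_Least[of i "\<lambda>j. m \<le> K j"] by simp
      moreover have "md j \<le> K i" using good[of i] Suc by (simp add: good_def)
      ultimately show ?thesis by simp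
    qed
    then have "\<delta> m \<le> e j / 4" by (rule md)
    also have "e j / 4 \<le> N (seq_tail (K j) (r 0))"
    proof -
      let ?t = "seq_tail (K j)"
      have tX: "?t v \<in> X" if "v \<in> X" for v using that by (rule tail_in)
      \<comment> \<open>The j-th term vanishes up to \<open>K j\<close>, so the truncation does not
        affect it.\<close>
      have u_eq: "?t (u j) = u j"
        using good[of j] by (auto simp: good_def seq_tail_def u_def cscale_def fun_eq_iff not_less)
      have "r 0 = y j + u j + r (Suc j)"
        using split[of "Suc j"] ySuc[of j] by (simp add: u_def)
      then have "?t (r 0) = ?t (y j) + u j + ?t (r (Suc j))"
        by (simp add: seq_tail_add u_eq)
      then have u_split: "u j = ?t (r 0) - ?t (y j) - ?t (r (Suc j))" by simp
      have "N (u j) \<le> N (?t (r 0) - ?t (y j)) + N (?t (r (Suc j)))"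
        by (subst u_split) (intro norm_diff diff_in tX rX yX)
      moreover have "N (?t (r 0) - ?t (y j)) \<le> N (?t (r 0)) + N (?t (y j))"
        by (intro norm_diff tX rX yX)
      moreover have "N (?t (y j)) \<le> e j / 4" using good[of j] by (simp add: good_def)
      moreover have "N (?t (r (Suc j))) \<le> e j / 3"
        using norm_tail_le[OF rX, of "K j" "Suc j"] Nr[of "Suc j"] by (simp add: e_def)
      ultimately show ?thesis using e_pos[of j] Nu[of j] by linarith
    qed
    also have "\<dots> \<le> N (seq_tail m (r 0))" by (rule norm_tail_mono[OF rX mK])
    finally show ?thesis .
  qed
  ultimately show ?thesis by blast
qed

end

subsection \<open>Weighted shift operators\<close>

text \<open>The operator is given by its coordinates on all of \<open>X\<close>;
  \<open>shift_operatorI\<close> obtains this from its values on basis vectors.\<close>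

locale shift_operator = banach_seq_space X N + bounded_weights w M
  for X N w M +
  fixes B :: "(nat \<Rightarrow> complex) \<Rightarrow> nat \<Rightarrow> complex"
  assumes B_eq: "x \<in> X \<Longrightarrow> B x = (\<lambda>i. if i = 0 then 0 else w (Suc i) * x (Suc i))"
begin

lemma B_in: "x \<in> X \<Longrightarrow> B x \<in> X"
proof (rule solid_in[of "cscale M (back_shift 1 x)"])
  assume x: "x \<in> X"
  then show "cscale M (back_shift 1 x) \<in> X" by (intro scale_in shift_in)
  show "cmod (B x n) \<le> cmod (cscale M (back_shift 1 x) n)" for n
    using one_le_bound weight_le[of "Suc n"]
    by (auto simp: B_eq[OF x] cscale_def back_shift_def norm_mult intro!: mult_right_mono)
qed

lemma B_pow_in: "x \<in> X \<Longrightarrow> (B ^^ n) x \<in> X"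
  by (induction n) (auto simp: B_in)

lemma B_pow_eq:
  assumes "x \<in> X"
  shows "(B ^^ n) x = (\<lambda>i. if i = 0 then 0 else weight_prod w i n * x (i + n))"
proof (induction n)
  case 0
  then show ?case using coord_0[OF assms] by auto
next
  case (Suc n)
  show ?case
    by (simp add: B_eq[OF B_pow_in[OF assms]] fun_eq_iff)
       (simp add: Suc weight_prod_Suc)
qed

lemma norm_B_pow_ge:
  assumes "x \<in> X" "a \<ge> 0" "\<And>k. k \<ge> 1 \<Longrightarrow> a \<le> cmod (weight_prod w k n)"
  shows "a * N (seq_tail n x) \<le> N ((B ^^ n) x)"
proof -
  have "N (cscale a (back_shift n x)) \<le> N ((B ^^ n) x)"
  proof (rule norm_mono[OF B_pow_in[OF assms(1)]])
    fix i show "cmod (cscale a (back_shift n x) i) \<le> cmod ((B ^^ n) x i)"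
      using assms by (auto simp: B_pow_eq cscale_def back_shift_def norm_mult intro!: mult_right_mono)
  qed
  then show ?thesis using assms by (simp add: norm_scale shift_in norm_shift)
qed

text \<open>Products are bounded only where \<open>x\<close> has a non-zero entry: in the
  construction they are controlled only when they end at one of the selected indices.\<close>

lemma norm_B_pow_le:
  assumes "x \<in> X" "a \<ge> 0" "\<And>k. k \<ge> 1 \<Longrightarrow> x (k + n) \<noteq> 0 \<Longrightarrow> cmod (weight_prod w k n) \<le> a"
  shows "N ((B ^^ n) x) \<le> a * N (seq_tail n x)"
proof -
  have "N ((B ^^ n) x) \<le> N (cscale a (back_shift n x))"
  proof (rule norm_mono)
    show "cscale a (back_shift n x) \<in> X" by (intro scale_in shift_in assms)
    fix i show "cmod ((B ^^ n) x i) \<le> cmod (cscale a (back_shift n x) i)"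
      using assms by (cases "x (i + n) = 0")
        (auto simp: B_pow_eq cscale_def back_shift_def norm_mult intro!: mult_right_mono)
  qed
  then show ?thesis using assms by (simp add: norm_scale shift_in norm_shift)
qed

lemma norm_B_pow_le_bound:
  assumes "x \<in> X"
  shows "N ((B ^^ n) x) \<le> M ^ n * N x"
proof -
  have "M ^ n \<ge> 0" using one_le_bound by simp
  then have "N ((B ^^ n) x) \<le> M ^ n * N (seq_tail n x)"
    using assms by (intro norm_B_pow_le weight_prod_le)
  also have "\<dots> \<le> M ^ n * N x"
    using \<open>M ^ n \<ge> 0\<close> by (rule mult_left_mono[OF norm_tail_le[OF assms]])
  finally show ?thesis .
qed

lemma hypercyclic_vector_iff:
  "hypercyclic_vector X N B x \<longleftrightarrow> x \<in> X \<and> (\<forall>y\<in>X. \<forall>r>0. \<exists>n\<ge>1. N ((B ^^ n) x - y) < r)"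
proof (cases "x \<in> X")
  case True
  define S where "S = {(B ^^ n) x |n. n \<ge> 1}"
  have sub: "S \<subseteq> X" using B_pow_in[OF True] by (auto simp: S_def)
  let ?cl = "norm_topology X N closure_of S"
  have "?cl \<subseteq> X" using in_closure_of_iff[OF sub] by (simp add: subset_iff)
  then have "?cl = X \<longleftrightarrow> (\<forall>y\<in>X. y \<in> ?cl)" by (simp add: set_eq_iff subset_iff) metis
  also have "\<dots> \<longleftrightarrow> (\<forall>y\<in>X. \<forall>r>0. \<exists>z\<in>S. N (z - y) < r)"
    by (simp add: in_closure_of_iff[OF sub])
  also have "\<dots> \<longleftrightarrow> (\<forall>y\<in>X. \<forall>r>0. \<exists>n\<ge>1. N ((B ^^ n) x - y) < r)"
  proof -
    have "(\<exists>z\<in>S. Q z) \<longleftrightarrow> (\<exists>n\<ge>1. Q ((B ^^ n) x))" for Q by (auto simp: S_def)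
    then show ?thesis by simp
  qed
  finally show ?thesis using True by (simp add: hypercyclic_vector_def S_def)
qed (simp add: hypercyclic_vector_def)

lemma no_hypercyclic_subspace:
  assumes a: "a > 1" and n0: "n0 \<ge> 1"
    and ge: "\<And>k. k \<ge> 1 \<Longrightarrow> a \<le> cmod (weight_prod w k n0)"
  shows "\<not> hypercyclic_subspace X N B V"
proof
  assume "hypercyclic_subspace X N B V"
  then have V: "V \<subseteq> X" "cseq.subspace V" "closedin (norm_topology X N) V" "infinite_dimensional V"
    and hyp: "\<And>x. x \<in> V \<Longrightarrow> x \<noteq> 0 \<Longrightarrow> hypercyclic_vector X N B x"
    by (auto simp: hypercyclic_subspace_def)
  \<comment> \<open>The reciprocal of the growth bound from \<open>weight_prod_exp_growth\<close>: a
    tail of norm at least \<open>\<delta> m\<close> is expanded to norm at least 1.\<close>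
  define \<delta> where "\<delta> m = M ^ n0 / a ^ (m div n0)" for m
  have "filterlim (\<lambda>m. m div n0) at_top sequentially"
    unfolding filterlim_at_top
  proof
    fix Z show "\<forall>\<^sub>F m in sequentially. Z \<le> m div n0"
      by (rule eventually_sequentiallyI[of "Z * n0"])
         (use n0 in \<open>simp add: less_eq_div_iff_mult_less_eq\<close>)
  qed
  then have "filterlim (\<lambda>m. a ^ (m div n0)) at_infinity sequentially"
    using a by (intro filterlim_compose[OF filterlim_realpow_sequentially_gt1]) auto
  then have "\<delta> \<longlonglongrightarrow> 0" unfolding \<delta>_def by (intro tendsto_divide_0[OF tendsto_const])
  from exists_slow_tails[OF V this] obtain x m0
    where x: "x \<in> V" "\<And>m. m \<ge> m0 \<Longrightarrow> \<delta> m \<le> N (seq_tail m x)" by blast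
  have xX: "x \<in> X" using x V by blast
  have Mpos: "M ^ n0 > 0" using one_le_bound by simp
  have ge1: "1 \<le> N ((B ^^ m) x)" if m: "m \<ge> m0" for m
  proof -
    let ?c = "a ^ (m div n0) / M ^ n0"
    have "1 = ?c * \<delta> m" using a Mpos one_le_bound by (simp add: \<delta>_def)
    also have "\<dots> \<le> ?c * N (seq_tail m x)" using x(2)[OF m] a Mpos by (intro mult_left_mono) auto
    also have "\<dots> \<le> N ((B ^^ m) x)"
    proof (rule norm_B_pow_ge[OF xX])
      show "?c \<ge> 0" using a Mpos by simp
      fix k :: nat assume "k \<ge> 1"
      then show "?c \<le> cmod (weight_prod w k m)"
        using weight_prod_exp_growth[OF n0 _ ge, of k m] a Mpos by (simp add: field_simps)
    qed
    finally show ?thesis .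
  qed
  \<comment> \<open>An orbit that reaches 0 stays there, contradicting the bound for late
    times.\<close>
  have pos: "N ((B ^^ n) x) > 0" for n
  proof -
    have "(B ^^ n) x \<noteq> 0"
    proof
      assume z: "(B ^^ n) x = 0"
      have "(B ^^ (m0 + n)) x = (B ^^ m0) 0" by (simp add: funpow_add z)
      also have "\<dots> = 0" by (simp add: B_pow_eq zero_in fun_eq_iff)
      finally show False using ge1[of "m0 + n"] norm_zero by simp
    qed
    then show ?thesis using norm_nonneg[OF B_pow_in[OF xX]] norm_eq_0[OF B_pow_in[OF xX]]
      by (metis less_eq_real_def)
  qed
  have "x \<noteq> 0" using pos[of 0] norm_zero by auto
  with hyp[OF x(1)] have "hypercyclic_vector X N B x" .
  have dense: "\<exists>n\<ge>1. N ((B ^^ n) x) < r" if "r > 0" for r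
  proof -
    have "\<exists>n\<ge>1. N ((B ^^ n) x - 0) < r"
      using \<open>hypercyclic_vector X N B x\<close> that zero_in unfolding hypercyclic_vector_iff by blast
    then show ?thesis by simp
  qed
  \<comment> \<open>Finitely many positive early norms together with the bound 1 afterwards keep the
    whole orbit away from 0.\<close>
  define r where "r = Min (insert 1 ((\<lambda>n. N ((B ^^ n) x)) ` {..m0}))"
  have "r > 0" using pos by (auto simp: r_def)
  moreover have "r \<le> N ((B ^^ n) x)" for n
  proof (cases "n \<le> m0")
    case True
    then show ?thesis unfolding r_def by (intro Min_le) auto
  next
    case False
    have "r \<le> 1" unfolding r_def by (intro Min_le) auto
    with False ge1[of n] show ?thesis by simp
  qed
  ultimately show False using dense[of r] by (meson not_less)
qed

end

text \<open>Continuity bounds the weights through the images of basis vectors. It also extends the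
  coordinate formula from finite combinations, because the images of tails tend to 0.\<close>

lemma shift_operatorI:
  assumes "banach_seq_space X N" and ws: "weighted_shift X N w B"
  shows "\<exists>M. shift_operator X N w M B"
proof -
  interpret banach_seq_space X N by fact
  have clo: "continuous_linear_operator X N B" and w0: "\<And>n. n \<ge> 1 \<Longrightarrow> w n \<noteq> 0"
    and Be: "\<And>n. n \<ge> 1 \<Longrightarrow> B (unit_seq n) = cscale (w n) (unit_seq (n - 1))"
    using ws by (auto simp: weighted_shift_def)
  have BX: "\<And>x. x \<in> X \<Longrightarrow> B x \<in> X" and Badd: "\<And>x y. x \<in> X \<Longrightarrow> y \<in> X \<Longrightarrow> B (x + y) = B x + B y"
    and Bsc: "\<And>c x. x \<in> X \<Longrightarrow> B (cscale c x) = cscale c (B x)"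
    using clo by (auto simp: continuous_linear_operator_def)
  obtain D where D: "D > 0" "\<And>x. x \<in> X \<Longrightarrow> N (B x) \<le> D * N x" 
    using bounded_operator[OF clo] by blast
  have wD: "cmod (w n) \<le> D" if n: "n \<ge> 2" for n
  proof -
    have "B (unit_seq n) (n - 1) = w n"
      using n by (subst Be) (auto simp: cscale_def unit_seq_def)
    then have "cmod (w n) = cmod (B (unit_seq n) (n - 1))" by simp
    also have "\<dots> \<le> N (B (unit_seq n))" by (intro coord_le BX unit_in)
    also have "\<dots> \<le> D * N (unit_seq n)" by (intro D unit_in)
    also have "\<dots> \<le> D * 1" using D norm_unit by (intro mult_left_mono) auto
    finally show ?thesis by simp
  qed
  have Bx: "B x i = (if i = 0 then 0 else w (Suc i) * x (Suc i))" if x: "x \<in> X" for x i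
  proof -
    let ?f = "if i = 0 then 0 else w (Suc i) * x (Suc i)"
    \<comment> \<open>Basis vectors are split off one at a time; only the one with index
      \<open>Suc i\<close> contributes to coordinate \<open>i\<close>.\<close>
    have "B x i = (if 0 < i \<and> i < K then ?f else 0) + B (seq_tail K x) i" for K
    proof (induction K)
      case 0
      have "seq_tail 0 x = x" using coord_0[OF x] by (auto simp: seq_tail_def fun_eq_iff)
      then show ?case by simp
    next
      case (Suc K)
      have "seq_tail K x = cscale (x (Suc K)) (unit_seq (Suc K)) + seq_tail (Suc K) x"
        by (auto simp: seq_tail_def cscale_def unit_seq_def fun_eq_iff dest: Suc_lessI)
      then have "B (seq_tail K x) = cscale (x (Suc K)) (cscale (w (Suc K)) (unit_seq K)) + B (seq_tail (Suc K) x)"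
        using x by (simp add: Badd Bsc Be scale_in unit_in tail_in)
      then show ?case using Suc by (auto simp: cscale_def unit_seq_def less_Suc_eq)
    qed
    then have le: "cmod (B x i - ?f) \<le> D * N (seq_tail K x)" if K: "K > i" for K
    proof -
      have "B x i - ?f = B (seq_tail K x) i"
        using K \<open>\<And>K. B x i = (if 0 < i \<and> i < K then ?f else 0) + B (seq_tail K x) i\<close>[of K] by auto
      also have "cmod \<dots> \<le> N (B (seq_tail K x))" using x by (intro coord_le BX tail_in)
      also have "\<dots> \<le> D * N (seq_tail K x)" using x by (intro D tail_in)
      finally show ?thesis .
    qed
    have "(\<lambda>K. D * N (seq_tail K x)) \<longlonglongrightarrow> D * 0" by (intro tendsto_mult tendsto_const tail_tendsto x)
    then have "cmod (B x i - ?f) \<le> D * 0"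
      by (rule LIMSEQ_le_const) (use le in \<open>auto intro!: exI[of _ "Suc i"]\<close>)
    then show ?thesis by simp
  qed
  have "shift_operator X N w (max 1 D) B"
  proof
    show "cmod (w n) \<le> max 1 D" if "2 \<le> n" for n using wD[OF that] by simp
    show "B x = (\<lambda>i. if i = 0 then 0 else w (Suc i) * x (Suc i))" if "x \<in> X" for x
      using Bx[OF that] by blast
  qed (use w0 in auto)
  then show ?thesis by blast
qed

subsection \<open>A hypercyclic subspace\<close>

context solid_seq_space
begin

lemma finite_support_in:
  assumes "x 0 = 0" "\<And>i. i > L \<Longrightarrow> x i = 0"
  shows "x \<in> X"
proof -
  have "(\<lambda>m. \<Sum>i<Suc L. cscale (x i) (unit_seq i) m) \<in> X" by (intro sum_in scale_in unit_in)
  also have "(\<lambda>m. \<Sum>i<Suc L. cscale (x i) (unit_seq i) m) = x"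
  proof
    fix m
    have "(\<Sum>i<Suc L. cscale (x i) (unit_seq i) m) = (\<Sum>i<Suc L. if i = m then x i else 0)"
      using assms(1) by (intro sum.cong) (auto simp: cscale_def unit_seq_def Suc_le_eq)
    also have "\<dots> = x m" using assms(2)[of m] by (auto simp: not_less)
    finally show "(\<Sum>i<Suc L. cscale (x i) (unit_seq i) m) = x m" .
  qed
  finally show ?thesis .
qed

end

lemma sum_fun_apply: "(\<Sum>v\<in>A. f v) m = (\<Sum>v\<in>A. f v (m::nat) :: complex)"
  by (induction A rule: infinite_finite_induct) auto

text \<open>Evaluation at \<open>k i\<close> isolates the i-th coefficient of a linear combination,
  so the \<open>b j\<close> are independent.\<close>

lemma infinite_dimensional_if_biorthogonal:
  assumes "\<And>j::nat. b j \<in> V" and dual: "\<And>i j. b j (k i) = (if i = j then 1 else 0)"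
  shows "infinite_dimensional V"
  unfolding infinite_dimensional_def
proof
  assume "\<exists>S. finite S \<and> V \<subseteq> cseq.span S"
  then obtain S where S: "finite S" "V \<subseteq> cseq.span S" by blast
  have "inj b"
  proof (rule injI)
    fix i j assume "b i = b j"
    then show "i = j" using dual[of i i] dual[of j i] by (simp split: if_splits)
  qed
  have "cseq.independent (range b)"
    unfolding cseq.dependent_explicit
  proof
    assume "\<exists>t u. finite t \<and> t \<subseteq> range b \<and> (\<Sum>v\<in>t. cscale (u v) v) = 0 \<and> (\<exists>v\<in>t. u v \<noteq> 0)"
    then obtain t u v where t: "finite t" "t \<subseteq> range b" "(\<Sum>v\<in>t. cscale (u v) v) = 0"
      and v: "v \<in> t" "u v \<noteq> 0" by blast
    obtain i where i: "v = b i" using t v by blast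
    have "0 = (\<Sum>v\<in>t. cscale (u v) v) (k i)" by (simp add: t(3))
    also have "\<dots> = (\<Sum>v'\<in>t. u v' * v' (k i))" by (simp add: sum_fun_apply cscale_def)
    also have "\<dots> = (\<Sum>v'\<in>t. if v' = v then u v' else 0)"
    proof (rule sum.cong)
      fix v' assume "v' \<in> t"
      then obtain j where "v' = b j" using t by blast
      then show "u v' * v' (k i) = (if v' = v then u v' else 0)"
        using dual \<open>inj b\<close> by (auto simp: i inj_eq)
    qed simp
    also have "\<dots> = u v" using t v by simp
    finally show False using v by simp
  qed
  moreover have "range b \<subseteq> cseq.span S" using assms(1) S(2) by blast
  ultimately have "finite (range b)" using cseq.independent_span_bound[OF S(1)] by blast
  then show False using \<open>inj b\<close> finite_imageD infinite_UNIV_nat by blast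
qed

section \<open>Small preimages, targets and the choice of indices\<close>

context shift_operator
begin

text \<open>The n-th power of the forward shift with reciprocal weights. It need not preserve
  \<open>X\<close>, so it is applied only to finitely supported sequences.\<close>

definition right_inverse :: "nat \<Rightarrow> (nat \<Rightarrow> complex) \<Rightarrow> nat \<Rightarrow> complex" where
  "right_inverse n y = (\<lambda>i. if i > n then y (i - n) / weight_prod w (i - n) n else 0)"

lemma right_inverse_in:
  assumes "\<And>i. i > L \<Longrightarrow> y i = 0"
  shows "right_inverse n y \<in> X"
  by (rule finite_support_in[of _ "n + L"]) (auto simp: right_inverse_def assms)

text \<open>The entries of a hypercyclic vector are bounded, so its orbit can come close to a vector
  with large entries at 1 to \<open>L\<close> only if the products at all these positions are large
  at the same time.\<close>

lemma weight_prod_unbounded: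
  assumes "hypercyclic X N B"
  shows "\<exists>n\<ge>n1. \<forall>m\<in>{1..L}. C \<le> cmod (weight_prod w m n)"
proof -
  obtain x where x: "x \<in> X" and dense: "\<And>y r. y \<in> X \<Longrightarrow> r > 0 \<Longrightarrow> \<exists>n\<ge>1. N ((B ^^ n) x - y) < r"
    using assms unfolding hypercyclic_def hypercyclic_vector_iff by blast
  \<comment> \<open>Position 1 is always included, and a product there above \<open>M ^ n1\<close>
    excludes times below \<open>n1\<close>.\<close>
  define L' C' where "L' = max 1 L" and "C' = max C (M ^ n1 + 1)"
  have C': "C' > 0" "C \<le> C'" "M ^ n1 < C'"
    using one_le_bound zero_le_power[of M n1] by (auto simp: C'_def less_max_iff_disj intro: add_nonneg_pos)
  define R where "R = C' * (N x + 1)"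
  have Nx: "N x \<ge> 0" by (rule norm_nonneg[OF x])
  have R: "R > 0" using C' Nx by (simp add: R_def)
  define y :: "nat \<Rightarrow> complex" where "y i = (if 1 \<le> i \<and> i \<le> L' then of_real (2 * R) else 0)" for i
  have y: "y \<in> X" by (rule finite_support_in[of _ L']) (auto simp: y_def)
  obtain n where n: "n \<ge> 1" "N ((B ^^ n) x - y) < R" using dense[OF y R] by blast
  have ge: "C' \<le> cmod (weight_prod w m n)" if m: "1 \<le> m" "m \<le> L'" for m
  proof -
    have "cmod (((B ^^ n) x - y) m) < R"
      using coord_le[of "(B ^^ n) x - y" m] n diff_in[OF B_pow_in[OF x] y] by simp
    then have "cmod (weight_prod w m n * x (m + n) - of_real (2 * R)) < R"
      using m by (simp add: B_pow_eq[OF x] y_def)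
    moreover have "2 * R \<le> cmod (weight_prod w m n * x (m + n)) + cmod (weight_prod w m n * x (m + n) - of_real (2 * R))"
      using norm_triangle_ineq4[of "weight_prod w m n * x (m + n)" "weight_prod w m n * x (m + n) - of_real (2 * R)"] R
      by simp
    ultimately have "R \<le> cmod (weight_prod w m n) * cmod (x (m + n))" by (simp add: norm_mult)
    also have "\<dots> \<le> cmod (weight_prod w m n) * (N x + 1)"
      using coord_le[OF x, of "m + n"] by (intro mult_left_mono) auto
    finally show ?thesis using Nx by (simp add: R_def)
  qed
  have "n1 \<le> n"
  proof (rule ccontr)
    assume "\<not> n1 \<le> n"
    then have "M ^ n \<le> M ^ n1" using one_le_bound by (intro power_increasing) auto
    then show False using ge[of 1] weight_prod_le[of 1 n] C' by (simp add: L'_def)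
  qed
  moreover have "C \<le> cmod (weight_prod w m n)" if "m \<in> {1..L}" for m
    using ge[of m] that C' by (auto simp: L'_def)
  ultimately show ?thesis by blast
qed

text \<open>The norm of \<open>right_inverse n y\<close> is that of \<open>y\<close> divided
  coordinatewise by products of length \<open>n\<close>, which are uniformly large on the support
  for suitable \<open>n\<close>.\<close>

lemma small_right_inverse:
  assumes "hypercyclic X N B" and y: "y 0 = 0" "\<And>i. i > L \<Longrightarrow> y i = 0" and e: "e > 0"
  shows "\<exists>n\<ge>n1. N (right_inverse n y) \<le> e"
proof -
  have yX: "y \<in> X" by (rule finite_support_in[of _ L]) (use y in auto)
  define C where "C = (N y + 1) / e"
  have C: "C > 0" using norm_nonneg[OF yX] e by (simp add: C_def)
  obtain n where n: "n \<ge> n1" "\<And>m. m \<in> {1..L} \<Longrightarrow> C \<le> cmod (weight_prod w m n)"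
    using weight_prod_unbounded[OF assms(1)] by blast
  let ?x = "right_inverse n y"
  have x: "?x \<in> X" by (rule right_inverse_in[OF y(2)])
  have "?x = seq_tail n ?x" by (auto simp: right_inverse_def seq_tail_def)
  then have "N ?x = N (back_shift n ?x)" using norm_shift[OF x, of n] by simp
  also have "\<dots> \<le> N (cscale (of_real (1 / C)) y)"
  proof (rule norm_mono)
    show "cscale (of_real (1 / C)) y \<in> X" by (rule scale_in[OF yX])
    fix i
    show "cmod (back_shift n ?x i) \<le> cmod (cscale (of_real (1 / C)) y i)"
    proof (cases "i \<in> {1..L}")
      case True
      then have "cmod (y i) / cmod (weight_prod w i n) \<le> cmod (y i) / C"
        using n(2)[OF True] C by (intro divide_left_mono) (auto simp: weight_prod_nonzero)
      then show ?thesis using True C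
        by (simp add: back_shift_def right_inverse_def cscale_def norm_divide)
    next
      case False
      then have "y i = 0" using y by (cases i) auto
      then show ?thesis by (simp add: back_shift_def right_inverse_def)
    qed
  qed
  also have "\<dots> = N y / C" using C norm_scale[OF yX, of "of_real (1 / C)"] by (simp add: norm_divide)
  also have "\<dots> \<le> e"
    using norm_nonneg[OF yX] e by (simp add: C_def field_simps)
  finally show ?thesis using n(1) by blast
qed

text \<open>The targets are truncations of one dense orbit; \<open>jj\<close> attaches labels to
  them. Each label must meet every neighbourhood at arbitrarily late stages.\<close>

lemma dense_targets:
  assumes "hypercyclic X N B"
  shows "\<exists>(y :: nat \<Rightarrow> nat \<Rightarrow> complex) L (jj :: nat \<Rightarrow> nat).
    (\<forall>s. y s 0 = 0) \<and> (\<forall>s i. i > L s \<longrightarrow> y s i = 0) \<and>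
    (\<forall>j e s0. \<forall>z\<in>X. e > 0 \<longrightarrow> (\<exists>s\<ge>s0. jj s = j \<and> N (y s - z) < e))"
proof -
  obtain x where x: "x \<in> X" and dense: "\<And>y r. y \<in> X \<Longrightarrow> r > 0 \<Longrightarrow> \<exists>n\<ge>1. N ((B ^^ n) x - y) < r"
    using assms unfolding hypercyclic_def hypercyclic_vector_iff by blast
  define jj where "jj s = fst (prod_decode s)" for s
  define L where "L s = fst (prod_decode (snd (prod_decode s)))" for s
  define nn where "nn s = fst (prod_decode (snd (prod_decode (snd (prod_decode s)))))" for s
  define y where "y s i = (if i \<le> L s then (B ^^ nn s) x i else 0)" for s i
  show ?thesis
  proof (rule exI[of _ y], rule exI[of _ L], rule exI[of _ jj], intro conjI allI impI ballI)
    show "y s 0 = 0" for s using coord_0[OF B_pow_in[OF x]] by (simp add: y_def)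
    show "y s i = 0" if "i > L s" for s i using that by (simp add: y_def)
    fix j s0 and z :: "nat \<Rightarrow> complex" and e :: real
    assume z: "z \<in> X" and e: "e > 0"
    obtain n where n: "N ((B ^^ n) x - z) < e / 2" using dense[OF z, of "e / 2"] e by auto
    let ?v = "(B ^^ n) x"
    have v: "?v \<in> X" by (rule B_pow_in[OF x])
    have "\<forall>\<^sub>F m in sequentially. N (seq_tail m ?v) < e / 2"
      using e by (intro order_tendstoD(2)[OF tail_tendsto[OF v]]) simp
    then obtain m where m: "N (seq_tail m ?v) < e / 2" unfolding eventually_sequentially by blast
    \<comment> \<open>The last component of the code is a dummy that makes each combination of
      label, truncation and time recur beyond any \<open>s0\<close>.\<close>
    define s where "s = prod_encode (j, prod_encode (m, prod_encode (n, s0)))"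
    have s: "jj s = j" "L s = m" "nn s = n" by (simp_all add: s_def jj_def L_def nn_def)
    have "s0 \<le> prod_encode (n, s0)" by (rule le_prod_encode_2)
    also have "\<dots> \<le> prod_encode (m, prod_encode (n, s0))" by (rule le_prod_encode_2)
    also have "\<dots> \<le> s" unfolding s_def by (rule le_prod_encode_2)
    finally have "s0 \<le> s" .
    moreover have "N (y s - z) < e"
    proof -
      have "y s - z = (?v - z) - seq_tail m ?v"
        by (auto simp: y_def s seq_tail_def fun_eq_iff)
      then have "N (y s - z) \<le> N (?v - z) + N (seq_tail m ?v)"
        using norm_diff[OF diff_in[OF v z] tail_in[OF v], of m] by (simp only:)
      then show ?thesis using n m by simp
    qed
    ultimately show "\<exists>s\<ge>s0. jj s = j \<and> N (y s - z) < e" using s(1) by blast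
  qed
qed

text \<open>The gap condition keeps the supports of the preimages off the indices
  \<open>k t\<close>. The other two bound, at time \<open>n s\<close>, the later basis vectors and
  the later preimages. Asking for all exponents up to \<open>n s\<close> lets conditions between
  consecutive stages pass to all pairs.\<close>

definition stages ::
  "(nat \<Rightarrow> nat \<Rightarrow> complex) \<Rightarrow> (nat \<Rightarrow> nat) \<Rightarrow> (nat \<Rightarrow> nat) \<Rightarrow> (nat \<Rightarrow> nat) \<Rightarrow> bool" where
  "stages y L k n \<longleftrightarrow> strict_mono k \<and> strict_mono n \<and> (\<forall>s. 0 < k s \<and> k s < n s) \<and>
    (\<forall>s t. s < t \<longrightarrow> n s + L s < k t) \<and>
    (\<forall>s t l. s < t \<longrightarrow> l \<le> n s \<longrightarrow> cmod (weight_prod w (k t - l) l) \<le> 2) \<and>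
    (\<forall>s t i. s < t \<longrightarrow> i \<le> n s \<longrightarrow> N ((B ^^ i) (right_inverse (n t) (y t))) \<le> (1 / 2) ^ t)"

lemma exists_stages:
  assumes hyp: "hypercyclic X N B"
    and small: "\<And>n. n \<ge> 1 \<Longrightarrow> \<exists>k\<ge>1. cmod (weight_prod w k n) \<le> C"
    and y: "\<And>s. y s 0 = 0" "\<And>s i. i > L s \<Longrightarrow> y s i = 0"
  shows "\<exists>k n. stages y L k n"
proof -
  define P where "P s kn \<longleftrightarrow> 0 < fst kn \<and> fst kn < snd kn" for s :: nat and kn :: "nat \<times> nat"
  define Q where "Q s kn kn' \<longleftrightarrow> snd kn + L s < fst kn' \<and>
      (\<forall>l\<le>snd kn. cmod (weight_prod w (fst kn' - l) l) \<le> 2) \<and>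
      (\<forall>i\<le>snd kn. N ((B ^^ i) (right_inverse (snd kn') (y (Suc s)))) \<le> (1 / 2) ^ Suc s)"
    for s and kn kn' :: "nat \<times> nat"
  have "\<exists>f. \<forall>s. P s (f s) \<and> Q s (f s) (f (Suc s))"
  proof (rule dependent_nat_choice)
    have "P 0 (1, 2)" by (simp add: P_def)
    then show "\<exists>kn. P 0 kn" ..
  next
    fix kn :: "nat \<times> nat" and s
    obtain k' where k': "k' \<ge> Suc (snd kn + L s)" "\<forall>l\<le>snd kn. cmod (weight_prod w (k' - l) l) \<le> 2"
      using exists_small_backward_products[of C "Suc (snd kn + L s)" "snd kn"] small by blast
    have M1: "1 \<le> M ^ i" for i using one_le_bound by simp
    \<comment> \<open>Dividing by \<open>M ^ snd kn\<close> absorbs the worst expansion up to the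
      previous time.\<close>
    obtain n' where n': "n' \<ge> Suc k'" "N (right_inverse n' (y (Suc s))) \<le> (1 / 2) ^ Suc s / M ^ snd kn"
      using small_right_inverse[where y = "y (Suc s)" and L = "L (Suc s)" and e = "(1 / 2) ^ Suc s / M ^ snd kn" and ?n1.0 = "Suc k'", OF hyp y]
        M1[of "snd kn"] by fastforce
    have "N ((B ^^ i) (right_inverse n' (y (Suc s)))) \<le> (1 / 2) ^ Suc s" if i: "i \<le> snd kn" for i
    proof -
      let ?z = "right_inverse n' (y (Suc s))"
      have z: "?z \<in> X" by (rule right_inverse_in[OF y(2)])
      have "N ((B ^^ i) ?z) \<le> M ^ i * N ?z" by (rule norm_B_pow_le_bound[OF z])
      also have "\<dots> \<le> M ^ snd kn * ((1 / 2) ^ Suc s / M ^ snd kn)"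
        using i one_le_bound n'(2) norm_nonneg[OF z] by (intro mult_mono power_increasing) auto
      also have "\<dots> = (1 / 2) ^ Suc s" using one_le_bound by simp
      finally show ?thesis .
    qed
    then have "P (Suc s) (k', n') \<and> Q s kn (k', n')" using k' n' by (simp add: P_def Q_def)
    then show "\<exists>kn'. P (Suc s) kn' \<and> Q s kn kn'" by blast
  qed
  then obtain f where f: "\<And>s. P s (f s)" "\<And>s. Q s (f s) (f (Suc s))" by blast
  define k n where "k s = fst (f s)" and "n s = snd (f s)" for s
  have kn: "0 < k s" "k s < n s" for s using f(1)[of s] by (simp_all add: P_def k_def n_def)
  have step: "n s + L s < k (Suc s)" "l \<le> n s \<Longrightarrow> cmod (weight_prod w (k (Suc s) - l) l) \<le> 2"
    "l \<le> n s \<Longrightarrow> N ((B ^^ l) (right_inverse (n (Suc s)) (y (Suc s)))) \<le> (1 / 2) ^ Suc s" for s l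
    using f(2)[of s] by (simp_all add: Q_def k_def n_def)
  have k_mono: "strict_mono k" unfolding strict_mono_Suc_iff
  proof
    fix s show "k s < k (Suc s)" using kn(2)[of s] step(1)[of s] by linarith
  qed
  have n_mono: "strict_mono n" unfolding strict_mono_Suc_iff
  proof
    fix s show "n s < n (Suc s)" using kn(2)[of "Suc s"] step(1)[of s] by linarith
  qed
  have "n s + L s < k t \<and> (l \<le> n s \<longrightarrow> cmod (weight_prod w (k t - l) l) \<le> 2) \<and>
      (l \<le> n s \<longrightarrow> N ((B ^^ l) (right_inverse (n t) (y t))) \<le> (1 / 2) ^ t)" if st: "s < t" for s t l
  proof (intro conjI impI)
    from st obtain t' where t': "t = Suc t'" "s \<le> t'" by (cases t) auto
    have nn: "n s \<le> n t'" using n_mono t'(2) by (simp add: strict_mono_less_eq)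
    have "k (Suc s) \<le> k t" using k_mono st by (simp add: strict_mono_less_eq Suc_le_eq)
    then show "n s + L s < k t" using step(1)[of s] by linarith
    assume l: "l \<le> n s"
    show "cmod (weight_prod w (k t - l) l) \<le> 2"
      unfolding t'(1) by (rule step(2)) (use l nn in linarith)
    show "N ((B ^^ l) (right_inverse (n t) (y t))) \<le> (1 / 2) ^ t"
      unfolding t'(1) by (rule step(3)) (use l nn in linarith)
  qed
  with k_mono n_mono kn have "stages y L k n" by (simp add: stages_def)
  then show ?thesis by blast
qed

text \<open>
  The subspace consists of the vectors \<open>\<Sum>j. a\<^sub>j e\<^bsub>k j\<^esub> + \<Sum>s. a\<^bsub>jj s\<^esub> z\<^sub>s\<close>, where \<open>B\<^bsup>n s\<^esup> z\<^sub>s = y\<^sub>s\<close>; it is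
  described through its coordinates, from which \<open>a\<^sub>j\<close> is read off at the index \<open>k j\<close>. At time
  \<open>n s\<close> the second sum is close to \<open>a\<^bsub>jj s\<^esub> y\<^sub>s\<close>, and the first one is bounded by twice a tail of \<open>a\<close>.
\<close>
lemma exists_hypercyclic_subspace:
  assumes hyp: "hypercyclic X N B"
    and small: "\<And>n. n \<ge> 1 \<Longrightarrow> \<exists>k\<ge>1. cmod (weight_prod w k n) \<le> C"
  shows "\<exists>V. hypercyclic_subspace X N B V"
proof -
  obtain y :: "nat \<Rightarrow> nat \<Rightarrow> complex" and L jj :: "nat \<Rightarrow> nat" where y: "\<And>s. y s 0 = 0" "\<And>s i. i > L s \<Longrightarrow> y s i = 0"
    and dense: "\<And>j z e s0. z \<in> X \<Longrightarrow> e > 0 \<Longrightarrow> \<exists>s\<ge>s0. jj s = j \<and> N (y s - z) < e"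
    using dense_targets[OF hyp] by blast
  obtain k n where "stages y L k n"
    using exists_stages[where y = y and L = L, OF hyp small y] by blast
  then have k_mono: "strict_mono k" and n_mono: "strict_mono n" and k_pos: "\<And>s. 0 < k s" and kn: "\<And>s. k s < n s"
    and nk: "\<And>s t. s < t \<Longrightarrow> n s + L s < k t"
    and back2: "\<And>s t l. s < t \<Longrightarrow> l \<le> n s \<Longrightarrow> cmod (weight_prod w (k t - l) l) \<le> 2"
    and Bz: "\<And>s t i. s < t \<Longrightarrow> i \<le> n s \<Longrightarrow> N ((B ^^ i) (right_inverse (n t) (y t))) \<le> (1 / 2) ^ t"
    by (simp_all add: stages_def)
  define z where "z s = right_inverse (n s) (y s)" for s
  have zX: "z s \<in> X" for s unfolding z_def by (rule right_inverse_in[OF y(2)])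
  have z_supp: "z s i = 0" if "i \<le> n s \<or> n s + L s < i" for s i
    using that y by (auto simp: z_def right_inverse_def)
  have n_ge: "s \<le> n s" for s using n_mono by (rule strict_mono_imp_increasing)
  \<comment> \<open>The perturbation leaves the entries at the indices \<open>k t\<close> alone, so
    they remain free coefficients.\<close>
  have zk: "z s (k t) = 0" for s t
  proof (cases "s < t")
    case True
    then show ?thesis using nk z_supp by blast
  next
    case False
    then have "k t \<le> k s" using k_mono by (simp add: strict_mono_less_eq)
    then show ?thesis using z_supp[of "k t" s] kn[of s] by simp
  qed
  have Nz: "N (z s) \<le> (1 / 2) ^ s" if "s \<ge> 1" for s
    using Bz[of 0 s 0] that by (simp add: z_def)
  have z_summable: "summable (\<lambda>s. c * N (z s))" for c
  proof -
    have "summable (\<lambda>s. N (z s))"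
      by (rule summable_comparison_test'[of "\<lambda>s. (1 / 2) ^ s" 1])
         (use Nz norm_nonneg[OF zX] in \<open>auto intro: summable_geometric\<close>)
    then show ?thesis by (rule summable_mult)
  qed
  \<comment> \<open>The support of \<open>z s\<close> lies beyond \<open>n s \<ge> s\<close>, so
    only s < m contributes at \<open>m\<close>. The equations defining \<open>V\<close> thus involve
    finitely many coordinates each and pass to limits.\<close>
  have sum_z: "(\<Sum>s. c s * z s m) = (\<Sum>s<m. c s * z s m)" for c m
  proof (rule suminf_finite)
    fix s assume "s \<notin> {..<m}"
    then have "m \<le> n s" using n_ge[of s] by simp
    then show "c s * z s m = 0" by (simp add: z_supp)
  qed simp
  have series_X: "(\<lambda>m. \<Sum>s. c s * z s m) \<in> X" if c: "\<And>s. cmod (c s) \<le> K" for c K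
  proof -
    have "(\<lambda>m. \<Sum>s. cscale (c s) (z s) m) \<in> X"
    proof (rule series_in)
      show "summable (\<lambda>s. N (cscale (c s) (z s)))"
        by (rule summable_comparison_test'[OF z_summable[of K], of 0])
           (use c norm_nonneg[OF zX] in \<open>auto simp: norm_scale zX intro: mult_right_mono\<close>)
    qed (rule scale_in[OF zX])
    then show ?thesis by (simp add: cscale_def)
  qed
  define V where "V = {x \<in> X. \<forall>m. m \<notin> range k \<longrightarrow> x m = (\<Sum>s<m. x (k (jj s)) * z s m)}"
  have VX: "V \<subseteq> X" by (auto simp: V_def)
  have "cseq.subspace V"
  proof (rule cseq.subspaceI)
    show "0 \<in> V" using zero_in by (simp add: V_def)
    show "x + x' \<in> V" if "x \<in> V" "x' \<in> V" for x x'
      using that by (auto simp: V_def add_in distrib_right sum.distrib)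
    show "cscale c x \<in> V" if "x \<in> V" for c x
      using that by (auto simp: V_def scale_in) (simp add: cscale_def sum_distrib_left mult.assoc)
  qed
  moreover have "closedin (norm_topology X N) V"
    unfolding closedin_iff[OF VX]
  proof (intro ballI impI)
    fix x assume x: "x \<in> X" and lim: "\<forall>r>0. \<exists>v\<in>V. N (v - x) < r"
    have "x m = (\<Sum>s<m. x (k (jj s)) * z s m)" if m: "m \<notin> range k" for m
    proof -
      let ?K = "1 + (\<Sum>s<m. cmod (z s m))"
      let ?d = "x m - (\<Sum>s<m. x (k (jj s)) * z s m)"
      have K: "?K > 0" by (simp add: add_pos_nonneg sum_nonneg)
      have le: "cmod ?d \<le> 0 + e" if e: "e > 0" for e
      proof -
        obtain v where v: "v \<in> V" "N (v - x) < e / ?K" using lim e K by (meson divide_pos_pos)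
        have co: "cmod (v i - x i) \<le> e / ?K" for i
        proof -
          have "cmod ((v - x) i) \<le> N (v - x)"
            by (intro coord_le diff_in x subsetD[OF VX v(1)])
          then show ?thesis using v(2) by simp
        qed
        have "v m = (\<Sum>s<m. v (k (jj s)) * z s m)" using v m by (simp add: V_def)
        then have "?d = (\<Sum>s<m. (v (k (jj s)) - x (k (jj s))) * z s m) - (v m - x m)"
          by (simp add: left_diff_distrib sum_subtractf)
        then have d_le: "cmod ?d \<le> cmod (\<Sum>s<m. (v (k (jj s)) - x (k (jj s))) * z s m) + cmod (v m - x m)"
          by (simp only: norm_triangle_ineq4)
        have "cmod ((v (k (jj s)) - x (k (jj s))) * z s m) \<le> e / ?K * cmod (z s m)" for s
          unfolding norm_mult by (rule mult_right_mono[OF co]) simp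
        then have "cmod (\<Sum>s<m. (v (k (jj s)) - x (k (jj s))) * z s m) \<le> (\<Sum>s<m. e / ?K * cmod (z s m))"
          by (intro sum_norm_le)
        then have "cmod ?d \<le> (\<Sum>s<m. e / ?K * cmod (z s m)) + e / ?K"
          using d_le co[of m] by linarith
        also have "\<dots> = e / ?K * ?K" by (simp only: sum_distrib_left distrib_left mult_1_right add.commute)
        also have "\<dots> = e" using K by simp
        finally show ?thesis by simp
      qed
      have "cmod ?d \<le> 0" by (rule field_le_epsilon) (rule le)
      then show ?thesis by simp
    qed
    then show "x \<in> V" using x by (simp add: V_def)
  qed
  moreover have "infinite_dimensional V"
  proof (rule infinite_dimensional_if_biorthogonal[where k = k])
    define c :: "nat \<Rightarrow> nat \<Rightarrow> complex" where "c j s = (if jj s = j then 1 else 0)" for j s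
    \<comment> \<open>The vector of \<open>V\<close> with j-th coefficient 1 and all others
      0.\<close>
    define b where "b j = unit_seq (k j) + (\<lambda>m. \<Sum>s. c j s * z s m)" for j
    show dual: "b j (k i) = (if i = j then 1 else 0)" for i j
      using k_mono k_pos[of j] by (auto simp: b_def zk unit_seq_def strict_mono_eq)
    show "b j \<in> V" for j
    proof -
      have "b j \<in> X" unfolding b_def
        by (intro add_in unit_in series_X[of _ 1]) (simp add: c_def)
      moreover have "b j m = (\<Sum>s<m. b j (k (jj s)) * z s m)" if "m \<notin> range k" for m
      proof -
        have "b j m = (\<Sum>s<m. c j s * z s m)"
          using that by (auto simp: b_def sum_z unit_seq_def)
        then show ?thesis unfolding dual c_def by simp
      qed
      ultimately show ?thesis by (simp add: V_def)
    qed
  qed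
  moreover have "hypercyclic_vector X N B x" if xV: "x \<in> V" and x0: "x \<noteq> 0" for x
    unfolding hypercyclic_vector_iff
  proof (intro conjI ballI allI impI)
    show x: "x \<in> X" using xV VX by blast
    have Nx: "N x \<ge> 0" by (rule norm_nonneg[OF x])
    have x_eq: "x m = (\<Sum>s<m. x (k (jj s)) * z s m)" if "m \<notin> range k" for m
      using xV that by (simp add: V_def)
    have "\<exists>j0. x (k j0) \<noteq> 0"
    proof (rule ccontr)
      assume "\<not> ?thesis"
      then have k0: "x (k j) = 0" for j by simp
      then have "x m = 0" for m using x_eq[of m] by (cases "m \<in> range k") auto
      then show False using x0 by (simp add: fun_eq_iff)
    qed
    then obtain j0 where j0: "x (k j0) \<noteq> 0" by blast
    define c where "c s = x (k (jj s))" for s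
    have c_le: "cmod (c s) \<le> N x" for s unfolding c_def by (rule coord_le[OF x])
    define a where "a m = (if m \<in> range k then x m else 0)" for m
    have aX: "a \<in> X" by (rule solid_in[OF x]) (simp add: a_def)
    have split: "x m = a m + (\<Sum>s. c s * z s m)" for m
    proof (cases "m \<in> range k")
      case True
      then show ?thesis by (auto simp: a_def zk)
    next
      case False
      then show ?thesis using x_eq[OF False] by (simp add: a_def sum_z c_def)
    qed
    have est: "N ((B ^^ n s) x - cscale (c s) (y s)) \<le> 2 * N (seq_tail (n s) x) + N x * (1 / 2) ^ s" for s
    proof -
      \<comment> \<open>The contributions of the stages after \<open>s\<close>, reindexed from
        0.\<close>
      define u where "u t = (B ^^ n s) (cscale (c (t + Suc s)) (z (t + Suc s)))" for t
      have uX: "u t \<in> X" for t unfolding u_def by (intro B_pow_in scale_in zX)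
      have Nu: "N (u t) \<le> N x * (1 / 2) ^ s * (1 / 2) ^ Suc t" for t
      proof -
        have "u t = cscale (c (t + Suc s)) ((B ^^ n s) (z (t + Suc s)))"
          unfolding u_def B_pow_eq[OF scale_in[OF zX]] B_pow_eq[OF zX]
          by (simp add: cscale_def fun_eq_iff)
        then have "N (u t) = cmod (c (t + Suc s)) * N ((B ^^ n s) (z (t + Suc s)))"
          by (simp add: norm_scale B_pow_in zX)
        also have "\<dots> \<le> N x * (1 / 2) ^ (t + Suc s)"
          using c_le Nx Bz[of s "t + Suc s" "n s"] norm_nonneg[OF B_pow_in[OF zX]]
          by (intro mult_mono) (auto simp: z_def)
        finally show ?thesis by (simp add: power_add mult_ac)
      qed
      have sums: "(\<lambda>t. N x * (1 / 2) ^ s * (1 / 2) ^ Suc t) sums (N x * (1 / 2) ^ s * 1)"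
        by (intro sums_mult power_half_series)
      have su: "summable (\<lambda>t. N (u t))"
        by (rule summable_comparison_test'[OF sums_summable[OF sums], of 0]) (use Nu norm_nonneg[OF uX] in auto)
      have RX: "(\<lambda>m. \<Sum>t. u t m) \<in> X" by (rule series_in[OF uX su])
      have "N (\<lambda>m. \<Sum>t. u t m) \<le> (\<Sum>t. N (u t))" by (rule norm_series[OF uX su])
      also have "\<dots> \<le> (\<Sum>t. N x * (1 / 2) ^ s * (1 / 2) ^ Suc t)"
        by (rule suminf_le[OF Nu su sums_summable[OF sums]])
      also have "\<dots> = N x * (1 / 2) ^ s" using sums_unique[OF sums] by simp
      finally have NR: "N (\<lambda>m. \<Sum>t. u t m) \<le> N x * (1 / 2) ^ s" .
      have "N ((B ^^ n s) a) \<le> 2 * N (seq_tail (n s) a)"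
      proof (rule norm_B_pow_le[OF aX])
        fix i :: nat assume i: "i \<ge> 1" "a (i + n s) \<noteq> 0"
        then obtain t where t: "i + n s = k t" by (auto simp: a_def split: if_splits)
        \<comment> \<open>Entries at \<open>k t\<close> with t at most s have been shifted out,
          since then \<open>k t < n s\<close>; for later ones the product ends at \<open>k t\<close>
          and is at most 2.\<close>
        have "s < t"
        proof (rule ccontr)
          assume "\<not> s < t"
          then have "k t \<le> k s" using k_mono by (simp add: strict_mono_less_eq)
          then show False using kn[of s] t by linarith
        qed
        moreover have "i = k t - n s" using t by simp
        ultimately show "cmod (weight_prod w i (n s)) \<le> 2" using back2[of s t "n s"] by simp
      qed simp
      also have "N (seq_tail (n s) a) \<le> N (seq_tail (n s) x)"
        by (rule norm_mono[OF tail_in[OF x]]) (simp add: seq_tail_def a_def)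
      finally have Na: "N ((B ^^ n s) a) \<le> 2 * N (seq_tail (n s) x)" by simp
      have eq: "(B ^^ n s) x - cscale (c s) (y s) = (B ^^ n s) a + (\<lambda>m. \<Sum>t. u t m)"
      proof
        fix i
        show "((B ^^ n s) x - cscale (c s) (y s)) i = ((B ^^ n s) a + (\<lambda>m. \<Sum>t. u t m)) i"
        proof (cases "i = 0")
          case True
          then show ?thesis using coord_0[OF uX] y(1) coord_0[OF B_pow_in] x aX
            by (simp add: cscale_def)
        next
          case False
          let ?m = "i + n s" and ?W = "weight_prod w i (n s)"
          have su_z: "summable (\<lambda>t. c t * z t ?m)"
            by (rule summable_finite[of "{..<?m}"])
               (use n_ge z_supp in \<open>auto simp: not_less intro: order_trans\<close>)
          \<comment> \<open>Earlier preimages are supported below \<open>k s < n s\<close> and have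
            been annihilated by time \<open>n s\<close>.\<close>
          have "(\<Sum>t<s. c t * z t ?m) = 0"
          proof (rule sum.neutral, rule ballI)
            fix t assume "t \<in> {..<s}"
            then have "n t + L t < k s" using nk by simp
            then have "n t + L t < ?m" using kn[of s] by linarith
            then show "c t * z t ?m = 0" by (simp add: z_supp)
          qed
          then have "(\<Sum>t<Suc s. c t * z t ?m) = c s * z s ?m" by simp
          then have "(\<Sum>t. c t * z t ?m) = (\<Sum>t. c (t + Suc s) * z (t + Suc s) ?m) + c s * z s ?m"
            using suminf_split_initial_segment[OF su_z, of "Suc s"] by simp
          then have "?W * x ?m = ?W * a ?m + ?W * (\<Sum>t. c (t + Suc s) * z (t + Suc s) ?m) + c s * (?W * z s ?m)"
            using split[of ?m] by (simp add: algebra_simps)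
          moreover have "?W * z s ?m = y s i"
            using False weight_prod_nonzero by (simp add: z_def right_inverse_def)
          moreover have "?W * (\<Sum>t. c (t + Suc s) * z (t + Suc s) ?m) = (\<Sum>t. u t i)"
          proof -
            have "u t i = ?W * (c (t + Suc s) * z (t + Suc s) ?m)" for t
              unfolding u_def B_pow_eq[OF scale_in[OF zX]] using False by (simp add: cscale_def)
            then show ?thesis
              using suminf_mult[OF summable_ignore_initial_segment[OF su_z, of "Suc s"], of ?W] by simp
          qed
          ultimately show ?thesis using False by (simp add: B_pow_eq x aX cscale_def)
        qed
      qed
      show ?thesis
        using norm_add[OF B_pow_in[OF aX] RX, of "n s"] Na NR unfolding eq by linarith
    qed
    fix v :: "nat \<Rightarrow> complex" and r :: real
    assume v: "v \<in> X" and r: "r > 0"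
    have "(\<lambda>s. 2 * N (seq_tail (n s) x) + N x * (1 / 2) ^ s) \<longlonglongrightarrow> 2 * 0 + N x * 0"
      using LIMSEQ_subseq_LIMSEQ[OF tail_tendsto[OF x] n_mono]
      by (intro tendsto_add tendsto_mult tendsto_const LIMSEQ_realpow_zero) (auto simp: o_def)
    then have "\<forall>\<^sub>F s in sequentially. 2 * N (seq_tail (n s) x) + N x * (1 / 2) ^ s < r / 2"
      using r by (intro order_tendstoD(2)) auto
    then obtain s0 where s0: "\<And>s. s \<ge> s0 \<Longrightarrow> 2 * N (seq_tail (n s) x) + N x * (1 / 2) ^ s < r / 2"
      unfolding eventually_sequentially by blast
    let ?c = "x (k j0)"
    \<comment> \<open>At a time with label \<open>j0\<close> the orbit is close to \<open>?c\<close>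
      times the target, so the target must approximate v divided by \<open>?c\<close>.\<close>
    let ?v = "cscale (1 / ?c) v"
    have vX: "?v \<in> X" by (rule scale_in[OF v])
    obtain s where s: "s \<ge> s0" "jj s = j0" "N (y s - ?v) < r / (2 * cmod ?c)"
      using dense[OF vX, of "r / (2 * cmod ?c)" s0 j0] r j0 by auto
    have yX: "y s \<in> X" by (rule finite_support_in[of _ "L s"]) (use y in auto)
    have cs: "c s = ?c" using s by (simp add: c_def)
    have "cscale ?c (y s) - v = cscale ?c (y s - ?v)"
      using j0 by (simp add: cscale_def fun_eq_iff algebra_simps)
    then have "N (cscale ?c (y s) - v) = cmod ?c * N (y s - ?v)"
      using norm_scale[OF diff_in[OF yX vX]] by simp
    also have "\<dots> < r / 2" using s(3) j0 by (simp add: field_simps)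
    finally have "N (cscale ?c (y s) - v) < r / 2" .
    moreover have "N ((B ^^ n s) x - cscale ?c (y s)) < r / 2"
      using est[of s] s0[OF s(1)] cs by simp
    moreover have "N ((B ^^ n s) x - v) \<le> N ((B ^^ n s) x - cscale ?c (y s)) + N (cscale ?c (y s) - v)"
      by (rule norm_diff_triangle[OF B_pow_in[OF x] scale_in[OF yX] v])
    ultimately have "N ((B ^^ n s) x - v) < r" by simp
    moreover have "n s \<ge> 1" using kn[of s] by simp
    ultimately show "\<exists>n\<ge>1. N ((B ^^ n) x - v) < r" by blast
  qed
  ultimately have "hypercyclic_subspace X N B V" using VX by (simp add: hypercyclic_subspace_def)
  then show ?thesis ..
qed

end

theorem theorem3p3:
  fixes X :: "(nat \<Rightarrow> complex) set" and N :: "(nat \<Rightarrow> complex) \<Rightarrow> real"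
    and w :: "nat \<Rightarrow> complex" and B :: "(nat \<Rightarrow> complex) \<Rightarrow> (nat \<Rightarrow> complex)"
  assumes "(\<exists>p\<ge>1. X = lp_space p \<and> N = lp_norm p) \<or> (X = c0_space \<and> N = c0_norm)"
    and "weighted_shift X N w B"
    and "hypercyclic X N B"
  shows "((\<exists>V. hypercyclic_subspace X N B V) \<longleftrightarrow>
           (SUP n\<in>{1..}. INF k\<in>{1..}. ereal (\<Prod>\<nu>=1..n. cmod (w (\<nu> + k)))) \<le> 1) \<and>
         ((\<exists>V. hypercyclic_subspace X N B V) \<longleftrightarrow>
           (SUP n\<in>{1..}. INF k\<in>{1..}. ereal (\<Prod>\<nu>=1..n. cmod (w (\<nu> + k)))) < \<infinity>)"
proof -
  have "banach_seq_space X N"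
    using assms(1) banach_seq_space_lp banach_seq_space_c0 by blast
  then obtain M where "shift_operator X N w M B"
    using shift_operatorI assms(2) by blast
  then interpret shift_operator X N w M B .
  define S where "S = (SUP n\<in>{1..}. INF k\<in>{1..}. ereal (\<Prod>\<nu>=1..n. cmod (w (\<nu> + k))))"
  have S_eq: "S = (SUP n\<in>{1..}. INF k\<in>{1..}. ereal (cmod (weight_prod w k n)))"
    by (simp add: S_def weight_prod_def prod_norm)
  have necessary: "S \<le> 1" if V: "hypercyclic_subspace X N B V" for V
  proof (rule ccontr)
    assume "\<not> S \<le> 1"
    then obtain n where n: "n \<ge> 1" "1 < (INF k\<in>{1..}. ereal (cmod (weight_prod w k n)))"
      unfolding S_eq not_le less_SUP_iff by auto
    \<comment> \<open>A real number strictly between 1 and the infimum is needed as a uniform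
      expansion factor, since the infimum is only an extended real.\<close>
    then obtain a where a: "1 < ereal a" "ereal a < (INF k\<in>{1..}. ereal (cmod (weight_prod w k n)))"
      using ereal_dense2 by blast
    have "a \<le> cmod (weight_prod w k n)" if "k \<ge> 1" for k
    proof -
      have "ereal a < ereal (cmod (weight_prod w k n))"
        by (rule less_INF_D[OF a(2)]) (use that in simp)
      then show ?thesis by simp
    qed
    with no_hypercyclic_subspace[of a n V] n(1) a(1) V show False by simp
  qed
  have sufficient: "\<exists>V. hypercyclic_subspace X N B V" if S: "S < \<infinity>"
  proof -
    obtain C where C: "S < ereal C" using ereal_dense2[OF S] by blast
    show ?thesis
    proof (rule exists_hypercyclic_subspace[OF assms(3)])
      fix n :: nat assume n: "n \<ge> 1"
      have "(INF k\<in>{1..}. ereal (cmod (weight_prod w k n))) \<le> S"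
        unfolding S_eq by (rule SUP_upper) (use n in simp)
      then have "(INF k\<in>{1..}. ereal (cmod (weight_prod w k n))) < ereal C"
        using C by (rule le_less_trans)
      then obtain k where "k \<ge> 1" "ereal (cmod (weight_prod w k n)) < ereal C"
        unfolding INF_less_iff by auto
      then show "\<exists>k\<ge>1. cmod (weight_prod w k n) \<le> C" by auto
    qed
  qed
  have "S < \<infinity>" if "S \<le> 1" using that by (rule le_less_trans) simp
  \<comment> \<open>Both equivalences follow from one cycle: a subspace gives supremum at most 1,
    hence finite, hence a subspace.\<close>
  then show ?thesis using necessary sufficient unfolding S_def by blast
qed

end
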